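(* Let $(E,\mathcal P)$ be a random locally convex module over $K$ with base $(\Omega,\mathcal F,P)$. Let $E^*_{\varepsilon,\lambda}:=(E,\mathcal P)^*_{\varepsilon,\lambda}$ and $E^*_c:=(E,\mathcal P)^*_c$ be its random conjugate spaces under the $(\varepsilon,\lambda)$-topology and the locally $L^0$-convex topology, respectively. Then $$E^*_{\varepsilon,\lambda}=(E,\mathcal P_{cc})^*_c=H_{cc}(E^*_c),$$ where $H_{cc}(E^*_c)$ is the countable concatenation hull of $E^*_c$ in $E^*_{\varepsilon,\lambda}$.
   Context: $(\Omega,\mathcal F,P)$ is a probability space and $K=\mathbb R$ or $\mathbb C$. $L^0(\mathcal F,K)$ is the algebra of (a.s.-equality) equivalence classes of $K$-valued $\mathcal F$-measurable random variables, $L^0(\mathcal F)=L^0(\mathcal F,\mathbb R)$ with the a.s. order, $L^0_+(\mathcal F)=\{\xi\in L^0(\mathcal F):\xi\ge0\}$, $L^0_{++}(\mathcal F)=\{\xi\in L^0(\mathcal F):\xi>0\text{ a.s. on }\Omega\}$. $\tilde I_A$ is the class of the indicator of $A\in\mathcal F$. An $L^0$-seminorm on an $L^0(\mathcal F,K)$-module $E$ is a map $\|\cdot\|:E\to L^0_+(\mathcal F)$ with $\|\xi x\|=|\xi|\|x\|$ and $\|x+y\|\le\|x\|+\|y\|$ for $\xi\in L^0(\mathcal F,K)$, $x,y\in E$. A random locally convex module over $K$ with base $(\Omega,\mathcal F,P)$ is a pair $(E,\mathcal P)$ with $E$ an $L^0(\mathcal F,K)$-module and $\mathcal P$ a family of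 $L^0$-seminorms on $E$ such that $\bigvee\{\|x\|:\|\cdot\|\in\mathcal P\}=0$ iff $x=\theta$ (the null element). For a finite subset $\mathcal Q\subset\mathcal P$ put $\|x\|_{\mathcal Q}=\bigvee\{\|x\|:\|\cdot\|\in\mathcal Q\}$. The countable concatenation hull of $\mathcal P$ is $\mathcal P_{cc}=\{\sum_{n=1}^\infty\tilde I_{A_n}\|\cdot\|_{\mathcal Q_n}:\{A_n\}$ a countable partition of $\Omega$ into sets of $\mathcal F$, $\{\mathcal Q_n\}$ a sequence of finite subsets of $\mathcal P\}$, again a family of $L^0$-seminorms making $E$ a random locally convex module. For such $(E,\mathcal P)$: the $(\varepsilon,\lambda)$-topology $\mathcal T_{\varepsilon,\lambda}$ is the linear topology with local base at $\theta$ consisting of $\{x\in E: P\{\|x\|_{\mathcal Q}<\varepsilon\}>1-\lambda\}$, $\mathcal Q\subset\mathcal P$ finite, $\varepsilon>0$, $0<\lambda<1$ real; the locally $L^0$-convex topology $\mathcal T_c$ has local base at $\theta$ consisting of $\{x\in E:\|x\|_{\mathcal Q}\le\varepsilon\}$, $\mathcal Q\subset\mathcal P$ finite, $\varepsilon\in L^0_{++}(\mathcal F)$. In particular, $L^0(\mathcal F,K)$ carries both topologies, induced by $|\cdot|$. $(E,\mathcal P)^*_{\varepsilon,\lambda}$ is the $L^0(\mathcal F,K)$-module of continuous module homomorphisms from $(E,\mathcal T_{\varepsilon,\lambda})$ to $(L^0(\mathcal F,K),\mathcal T_{\varepsilon,\lambda})$; $(E,\mathcal P)^*_c$ is the $L^0(\mathcal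 F,K)$-module of continuous module homomorphisms from $(E,\mathcal T_c)$ to $(L^0(\mathcal F,K),\mathcal T_c)$. $H_{cc}(E^*_c)$ is the set of all $f=\sum_n\tilde I_{A_n}f_n$, i.e. $\tilde I_{A_n}f=\tilde I_{A_n}f_n$ for all $n$, with $\{A_n\}$ a countable partition of $\Omega$ into sets of $\mathcal F$ and $\{f_n\}$ a sequence in $E^*_c$ (each such $f$ lies in $E^*_{\varepsilon,\lambda}$, since it is known that $E^*_{\varepsilon,\lambda}$ contains $E^*_c$ and is closed under countable concatenations). *)

theory Defs
  imports "HOL-Probability.Probability" "HOL-Algebra.Module" "HOL-Algebra.Lattice"
begin

section \<open>The algebra of classes of random variables\<close>

text \<open>
  The scalar field is a type of class \<open>{real_normed_field, euclidean_space}\<close>. A commutative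
  finite-dimensional real division algebra with a multiplicative norm is isometrically isomorphic
  to the real or to the complex numbers, so this class is exactly the choice of scalars
  \<open>K = real\<close> or \<open>K = complex\<close>.

  The elements of \<open>L0 M\<close> are equivalence classes, that is, sets of random variables. Classes depend
  on the measure \<open>M\<close>, hence they form a carrier set rather than a type.
\<close>

definition L0_class :: "'w measure \<Rightarrow> ('w \<Rightarrow> 'k::real_normed_field) \<Rightarrow> ('w \<Rightarrow> 'k) set" where
  "L0_class M f = {g \<in> borel_measurable M. AE w in M. g w = f w}"

definition L0_rep :: "('w \<Rightarrow> 'k) set \<Rightarrow> 'w \<Rightarrow> 'k" where
  "L0_rep \<xi> = (SOME f. f \<in> \<xi>)"

text \<open>
  One record serves both as the ring of scalars and as this ring regarded as a module over itself.
\<close>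

definition L0 :: "'w measure \<Rightarrow> (('w \<Rightarrow> 'k::real_normed_field) set, ('w \<Rightarrow> 'k) set) module" where
  "L0 M =
    \<lparr>carrier = L0_class M ` borel_measurable M,
     mult = (\<lambda>\<xi> \<eta>. L0_class M (\<lambda>w. L0_rep \<xi> w * L0_rep \<eta> w)),
     one = L0_class M (\<lambda>w. 1),
     zero = L0_class M (\<lambda>w. 0),
     add = (\<lambda>\<xi> \<eta>. L0_class M (\<lambda>w. L0_rep \<xi> w + L0_rep \<eta> w)),
     smult = (\<lambda>\<xi> \<eta>. L0_class M (\<lambda>w. L0_rep \<xi> w * L0_rep \<eta> w))\<rparr>"

definition L0_ind :: "'w measure \<Rightarrow> 'w set \<Rightarrow> ('w \<Rightarrow> 'k::real_normed_field) set" where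
  "L0_ind M A = L0_class M (indicator A)"

definition L0_abs :: "'w measure \<Rightarrow> ('w \<Rightarrow> 'k::real_normed_field) set \<Rightarrow> ('w \<Rightarrow> real) set" where
  "L0_abs M \<xi> = L0_class M (\<lambda>w. norm (L0_rep \<xi> w))"

definition L0_le :: "'w measure \<Rightarrow> ('w \<Rightarrow> real) set \<Rightarrow> ('w \<Rightarrow> real) set \<Rightarrow> bool" where
  "L0_le M \<xi> \<eta> \<longleftrightarrow> (AE w in M. L0_rep \<xi> w \<le> L0_rep \<eta> w)"

text \<open>
  The ordered set of nonnegative classes. Suprema of sets of values of seminorms are taken here; in
  particular the supremum of the empty set is \<open>0\<close>.
\<close>

definition L0_plus :: "'w measure \<Rightarrow> ('w \<Rightarrow> real) set gorder" where
  "L0_plus M =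
    \<lparr>carrier = {\<xi> \<in> carrier (L0 M). L0_le M \<zero>\<^bsub>L0 M\<^esub> \<xi>}, eq = (=), le = L0_le M\<rparr>"

definition L0_pp :: "'w measure \<Rightarrow> ('w \<Rightarrow> real) set set" where
  "L0_pp M = {\<xi> \<in> carrier (L0 M). AE w in M. 0 < L0_rep \<xi> w}"


section \<open>Random locally convex modules\<close>

text \<open>
  The modules are those of \<open>HOL-Algebra\<close>; the qualified name distinguishes the locale from the
  locale \<open>Modules.module\<close> of \<open>HOL\<close>.
\<close>

definition L0_seminorm ::
  "'w measure \<Rightarrow> (('w \<Rightarrow> 'k::real_normed_field) set, 'e) module
    \<Rightarrow> ('e \<Rightarrow> ('w \<Rightarrow> real) set) \<Rightarrow> bool" where
  "L0_seminorm M E p \<longleftrightarrow>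
    p \<in> carrier E \<rightarrow> carrier (L0_plus M) \<and>
    (\<forall>\<xi>\<in>carrier (L0 M). \<forall>x\<in>carrier E. p (\<xi> \<odot>\<^bsub>E\<^esub> x) = L0_abs M \<xi> \<otimes>\<^bsub>L0 M\<^esub> p x) \<and>
    (\<forall>x\<in>carrier E. \<forall>y\<in>carrier E. L0_le M (p (x \<oplus>\<^bsub>E\<^esub> y)) (p x \<oplus>\<^bsub>L0 M\<^esub> p y))"

text \<open>
  In the last clause, \<open>least L u (Upper L S)\<close> says that the supremum of \<open>S\<close> in \<open>L\<close> exists and is
  \<open>u\<close>. An infinite family need not have a supremum in \<open>L0_plus M\<close>.
\<close>

definition random_locally_convex_module ::
  "'w measure \<Rightarrow> (('w \<Rightarrow> 'k::real_normed_field) set, 'e) module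
    \<Rightarrow> ('e \<Rightarrow> ('w \<Rightarrow> real) set) set \<Rightarrow> bool" where
  "random_locally_convex_module M E P \<longleftrightarrow>
    Module.module (L0 M) E \<and>
    (\<forall>p\<in>P. L0_seminorm M E p) \<and>
    (\<forall>x\<in>carrier E.
      least (L0_plus M) \<zero>\<^bsub>L0 M\<^esub> (Upper (L0_plus M) ((\<lambda>p. p x) ` P)) \<longleftrightarrow> x = \<zero>\<^bsub>E\<^esub>)"

definition sup_seminorm ::
  "'w measure \<Rightarrow> ('e \<Rightarrow> ('w \<Rightarrow> real) set) set \<Rightarrow> 'e \<Rightarrow> ('w \<Rightarrow> real) set" where
  "sup_seminorm M Q x = \<Squnion>\<^bsub>L0_plus M\<^esub> ((\<lambda>p. p x) ` Q)"

definition measurable_partition :: "'w measure \<Rightarrow> (nat \<Rightarrow> 'w set) \<Rightarrow> bool" where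
  "measurable_partition M A \<longleftrightarrow>
    (\<forall>n. A n \<in> sets M) \<and> disjoint_family A \<and> (\<Union>n. A n) = space M"

text \<open>
  At every point of the sample space at most one term of the series is nonzero.
\<close>

definition cc_seminorm ::
  "'w measure \<Rightarrow> (nat \<Rightarrow> 'w set) \<Rightarrow> (nat \<Rightarrow> ('e \<Rightarrow> ('w \<Rightarrow> real) set) set)
    \<Rightarrow> 'e \<Rightarrow> ('w \<Rightarrow> real) set" where
  "cc_seminorm M A Q x =
    L0_class M (\<lambda>w. \<Sum>n. indicator (A n) w * L0_rep (sup_seminorm M (Q n) x) w)"

definition cc_family ::
  "'w measure \<Rightarrow> ('e \<Rightarrow> ('w \<Rightarrow> real) set) set \<Rightarrow> ('e \<Rightarrow> ('w \<Rightarrow> real) set) set" where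
  "cc_family M P =
    {cc_seminorm M A Q | A Q. measurable_partition M A \<and> (\<forall>n. finite (Q n) \<and> Q n \<subseteq> P)}"


section \<open>The two topologies\<close>

text \<open>
  The topology whose neighbourhoods of \<open>x\<close> are generated by the translates \<open>x + V\<close> of the members
  \<open>V\<close> of a local base at the null element.
\<close>

definition translation_topology :: "('a, 'e) module \<Rightarrow> 'e set set \<Rightarrow> 'e topology" where
  "translation_topology E \<B> =
    topology (\<lambda>U. U \<subseteq> carrier E \<and> (\<forall>x\<in>U. \<exists>V\<in>\<B>. (\<lambda>v. x \<oplus>\<^bsub>E\<^esub> v) ` V \<subseteq> U))"

definition eps_lambda_base ::
  "'w measure \<Rightarrow> ('a, 'e) module \<Rightarrow> ('e \<Rightarrow> ('w \<Rightarrow> real) set) set \<Rightarrow> 'e set set" where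
  "eps_lambda_base M E P =
    {{x \<in> carrier E. measure M {w \<in> space M. L0_rep (sup_seminorm M Q x) w < \<epsilon>} > 1 - \<delta>} | Q \<epsilon> \<delta>.
      finite Q \<and> Q \<subseteq> P \<and> (0::real) < \<epsilon> \<and> (0::real) < \<delta> \<and> \<delta> < 1}"

definition L0_convex_base ::
  "'w measure \<Rightarrow> ('a, 'e) module \<Rightarrow> ('e \<Rightarrow> ('w \<Rightarrow> real) set) set \<Rightarrow> 'e set set" where
  "L0_convex_base M E P =
    {{x \<in> carrier E. L0_le M (sup_seminorm M Q x) \<epsilon>} | Q \<epsilon>.
      finite Q \<and> Q \<subseteq> P \<and> \<epsilon> \<in> L0_pp M}"

definition eps_lambda_topology ::
  "'w measure \<Rightarrow> ('a, 'e) module \<Rightarrow> ('e \<Rightarrow> ('w \<Rightarrow> real) set) set \<Rightarrow> 'e topology" where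
  "eps_lambda_topology M E P = translation_topology E (eps_lambda_base M E P)"

definition L0_convex_topology ::
  "'w measure \<Rightarrow> ('a, 'e) module \<Rightarrow> ('e \<Rightarrow> ('w \<Rightarrow> real) set) set \<Rightarrow> 'e topology" where
  "L0_convex_topology M E P = translation_topology E (L0_convex_base M E P)"


section \<open>Random conjugate spaces\<close>

text \<open>
  Maps on \<open>carrier E\<close> with values in \<open>L0 M\<close> are extensional functions, so that equality of functions
  is equality of maps.
\<close>

definition L0_hom ::
  "'w measure \<Rightarrow> (('w \<Rightarrow> 'k::real_normed_field) set, 'e) module
    \<Rightarrow> ('e \<Rightarrow> ('w \<Rightarrow> 'k) set) set" where
  "L0_hom M E =
    {f \<in> carrier E \<rightarrow>\<^sub>E carrier (L0 M).
      (\<forall>x\<in>carrier E. \<forall>y\<in>carrier E. f (x \<oplus>\<^bsub>E\<^esub> y) = f x \<oplus>\<^bsub>L0 M\<^esub> f y) \<and>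
      (\<forall>\<xi>\<in>carrier (L0 M). \<forall>x\<in>carrier E. f (\<xi> \<odot>\<^bsub>E\<^esub> x) = \<xi> \<odot>\<^bsub>L0 M\<^esub> f x)}"

definition dual_eps_lambda ::
  "'w measure \<Rightarrow> (('w \<Rightarrow> 'k::real_normed_field) set, 'e) module
    \<Rightarrow> ('e \<Rightarrow> ('w \<Rightarrow> real) set) set \<Rightarrow> ('e \<Rightarrow> ('w \<Rightarrow> 'k) set) set" where
  "dual_eps_lambda M E P =
    {f \<in> L0_hom M E.
      continuous_map (eps_lambda_topology M E P) (eps_lambda_topology M (L0 M) {L0_abs M}) f}"

definition dual_c ::
  "'w measure \<Rightarrow> (('w \<Rightarrow> 'k::real_normed_field) set, 'e) module
    \<Rightarrow> ('e \<Rightarrow> ('w \<Rightarrow> real) set) set \<Rightarrow> ('e \<Rightarrow> ('w \<Rightarrow> 'k) set) set" where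
  "dual_c M E P =
    {f \<in> L0_hom M E.
      continuous_map (L0_convex_topology M E P) (L0_convex_topology M (L0 M) {L0_abs M}) f}"

text \<open>
  Membership of \<open>f\<close> in the ambient conjugate space is not demanded: \<open>f\<close> ranges over all maps on
  \<open>carrier E\<close>, without any linearity or continuity.
\<close>

definition cc_hull ::
  "'w measure \<Rightarrow> (('w \<Rightarrow> 'k::real_normed_field) set, 'e) module
    \<Rightarrow> ('e \<Rightarrow> ('w \<Rightarrow> 'k) set) set \<Rightarrow> ('e \<Rightarrow> ('w \<Rightarrow> 'k) set) set" where
  "cc_hull M E G =
    {f \<in> carrier E \<rightarrow>\<^sub>E carrier (L0 M).
      \<exists>A g. measurable_partition M A \<and> (\<forall>n. g n \<in> G) \<and>
        (\<forall>n. \<forall>x\<in>carrier E.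
          L0_ind M (A n) \<odot>\<^bsub>L0 M\<^esub> f x = L0_ind M (A n) \<odot>\<^bsub>L0 M\<^esub> g n x)}"


section \<open>Well-definedness\<close>

text \<open>
  The operations on classes do not depend on representatives, \<open>L0 M\<close> is a commutative ring and a
  module over itself, finite suprema are pointwise maxima, and both topologies have the intended
  open sets (a constant defined by \<open>topology\<close> is meaningful only if \<open>istopology\<close> holds).
\<close>


lemma L0_carrier: "carrier (L0 M) = L0_class M ` borel_measurable M"
  by (simp add: L0_def)

lemma L0_class_cong:
  assumes "AE w in M. f w = g w"
  shows "L0_class M f = L0_class M g"
  unfolding L0_class_def
proof (intro Collect_cong conj_cong refl iffI)
  fix h assume "AE w in M. h w = f w" with assms show "AE w in M. h w = g w" by eventually_elim simp
next
  fix h assume "AE w in M. h w = g w" with assms show "AE w in M. h w = f w" by eventually_elim simp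
qed

lemma L0_rep_in_class:
  assumes "f \<in> borel_measurable M"
  shows "L0_rep (L0_class M f) \<in> L0_class M f"
proof -
  have "f \<in> L0_class M f" using assms by (simp add: L0_class_def)
  then show ?thesis unfolding L0_rep_def by (rule someI[where P="\<lambda>g. g \<in> L0_class M f"])
qed

lemma L0_rep_class:
  "f \<in> borel_measurable M \<Longrightarrow> AE w in M. L0_rep (L0_class M f) w = f w"
  using L0_rep_in_class by (auto simp: L0_class_def)

lemma L0_rep_measurable:
  "\<xi> \<in> carrier (L0 M) \<Longrightarrow> L0_rep \<xi> \<in> borel_measurable M"
  using L0_rep_in_class by (auto simp: L0_carrier L0_class_def)

lemma L0_class_rep: "\<xi> \<in> carrier (L0 M) \<Longrightarrow> L0_class M (L0_rep \<xi>) = \<xi>"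
  by (auto simp: L0_carrier intro!: L0_class_cong L0_rep_class)

lemma L0_class_closed: "f \<in> borel_measurable M \<Longrightarrow> L0_class M f \<in> carrier (L0 M)"
  by (simp add: L0_carrier)

lemma L0_cases:
  assumes "\<xi> \<in> carrier (L0 M)"
  obtains f where "f \<in> borel_measurable M" "\<xi> = L0_class M f"
  using assms by (auto simp: L0_carrier)

lemma L0_class_ops:
  fixes f g :: "'w \<Rightarrow> 'k::{real_normed_field, euclidean_space}"
  assumes [measurable]: "f \<in> borel_measurable M" "g \<in> borel_measurable M"
  shows "L0_class M f \<oplus>\<^bsub>L0 M\<^esub> L0_class M g = L0_class M (\<lambda>w. f w + g w)"
    and "L0_class M f \<otimes>\<^bsub>L0 M\<^esub> L0_class M g = L0_class M (\<lambda>w. f w * g w)"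
    and "L0_class M f \<odot>\<^bsub>L0 M\<^esub> L0_class M g = L0_class M (\<lambda>w. f w * g w)"
  using L0_rep_class[OF assms(1)] L0_rep_class[OF assms(2)]
  by (auto simp: L0_def intro!: L0_class_cong)

lemma L0_zero: "\<zero>\<^bsub>L0 M\<^esub> = L0_class M (\<lambda>_. 0)"
  and L0_one: "\<one>\<^bsub>L0 M\<^esub> = L0_class M (\<lambda>_. 1)"
  by (simp_all add: L0_def)

lemma L0_cring:
  "cring (L0 M :: (('w \<Rightarrow> 'k::{real_normed_field, euclidean_space}) set, _) module)"
proof (rule cringI)
  show "abelian_group (L0 M :: (('w \<Rightarrow> 'k) set, _) module)"
  proof (rule abelian_groupI)
    fix \<xi> \<eta> \<zeta> :: "('w \<Rightarrow> 'k) set"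
    assume "\<xi> \<in> carrier (L0 M)" "\<eta> \<in> carrier (L0 M)" "\<zeta> \<in> carrier (L0 M)"
    then obtain f g h where f: "f \<in> borel_measurable M" "g \<in> borel_measurable M" "h \<in> borel_measurable M"
      and eq: "\<xi> = L0_class M f" "\<eta> = L0_class M g" "\<zeta> = L0_class M h"
      by (metis L0_cases)
    show "\<xi> \<oplus>\<^bsub>L0 M\<^esub> \<eta> \<oplus>\<^bsub>L0 M\<^esub> \<zeta> = \<xi> \<oplus>\<^bsub>L0 M\<^esub> (\<eta> \<oplus>\<^bsub>L0 M\<^esub> \<zeta>)"
      using f by (simp add: eq L0_class_ops add.assoc)
  next
    fix \<xi> \<eta> :: "('w \<Rightarrow> 'k) set"
    assume "\<xi> \<in> carrier (L0 M)" "\<eta> \<in> carrier (L0 M)"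
    then obtain f g where f: "f \<in> borel_measurable M" "g \<in> borel_measurable M"
      and eq: "\<xi> = L0_class M f" "\<eta> = L0_class M g"
      by (metis L0_cases)
    show "\<xi> \<oplus>\<^bsub>L0 M\<^esub> \<eta> = \<eta> \<oplus>\<^bsub>L0 M\<^esub> \<xi>" "\<xi> \<oplus>\<^bsub>L0 M\<^esub> \<eta> \<in> carrier (L0 M)"
      using f by (simp_all add: eq L0_class_ops add.commute L0_class_closed)
  next
    fix \<xi> :: "('w \<Rightarrow> 'k) set"
    assume "\<xi> \<in> carrier (L0 M)"
    then obtain f where f: "f \<in> borel_measurable M" and \<xi>: "\<xi> = L0_class M f" by (rule L0_cases)
    show "\<zero>\<^bsub>L0 M\<^esub> \<oplus>\<^bsub>L0 M\<^esub> \<xi> = \<xi>"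
      using f by (simp add: \<xi> L0_zero L0_class_ops)
    have "L0_class M (\<lambda>w. - f w) \<oplus>\<^bsub>L0 M\<^esub> \<xi> = \<zero>\<^bsub>L0 M\<^esub>"
      using f by (simp add: \<xi> L0_zero L0_class_ops)
    moreover have "L0_class M (\<lambda>w. - f w) \<in> carrier (L0 M)"
      using f by (simp add: L0_class_closed)
    ultimately show "\<exists>\<eta>\<in>carrier (L0 M). \<eta> \<oplus>\<^bsub>L0 M\<^esub> \<xi> = \<zero>\<^bsub>L0 M\<^esub>" by blast
  qed (simp add: L0_zero L0_class_closed)
  show "Group.comm_monoid (L0 M :: (('w \<Rightarrow> 'k) set, _) module)"
  proof (rule comm_monoidI)
    fix \<xi> \<eta> \<zeta> :: "('w \<Rightarrow> 'k) set"
    assume "\<xi> \<in> carrier (L0 M)" "\<eta> \<in> carrier (L0 M)" "\<zeta> \<in> carrier (L0 M)"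
    then obtain f g h where f: "f \<in> borel_measurable M" "g \<in> borel_measurable M" "h \<in> borel_measurable M"
      and eq: "\<xi> = L0_class M f" "\<eta> = L0_class M g" "\<zeta> = L0_class M h"
      by (metis L0_cases)
    show "\<xi> \<otimes>\<^bsub>L0 M\<^esub> \<eta> \<otimes>\<^bsub>L0 M\<^esub> \<zeta> = \<xi> \<otimes>\<^bsub>L0 M\<^esub> (\<eta> \<otimes>\<^bsub>L0 M\<^esub> \<zeta>)"
      using f by (simp add: eq L0_class_ops mult.assoc)
  next
    fix \<xi> \<eta> :: "('w \<Rightarrow> 'k) set"
    assume "\<xi> \<in> carrier (L0 M)" "\<eta> \<in> carrier (L0 M)"
    then obtain f g where f: "f \<in> borel_measurable M" "g \<in> borel_measurable M"
      and eq: "\<xi> = L0_class M f" "\<eta> = L0_class M g"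
      by (metis L0_cases)
    show "\<xi> \<otimes>\<^bsub>L0 M\<^esub> \<eta> = \<eta> \<otimes>\<^bsub>L0 M\<^esub> \<xi>" "\<xi> \<otimes>\<^bsub>L0 M\<^esub> \<eta> \<in> carrier (L0 M)"
      using f by (simp_all add: eq L0_class_ops mult.commute L0_class_closed)
  next
    fix \<xi> :: "('w \<Rightarrow> 'k) set"
    assume "\<xi> \<in> carrier (L0 M)"
    then obtain f where f: "f \<in> borel_measurable M" and \<xi>: "\<xi> = L0_class M f" by (rule L0_cases)
    show "\<one>\<^bsub>L0 M\<^esub> \<otimes>\<^bsub>L0 M\<^esub> \<xi> = \<xi>"
      using f by (simp add: \<xi> L0_one L0_class_ops)
  qed (simp add: L0_one L0_class_closed)
  fix \<xi> \<eta> \<zeta> :: "('w \<Rightarrow> 'k) set"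
  assume "\<xi> \<in> carrier (L0 M)" "\<eta> \<in> carrier (L0 M)" "\<zeta> \<in> carrier (L0 M)"
  then obtain f g h where f: "f \<in> borel_measurable M" "g \<in> borel_measurable M" "h \<in> borel_measurable M"
    and eq: "\<xi> = L0_class M f" "\<eta> = L0_class M g" "\<zeta> = L0_class M h"
    by (metis L0_cases)
  show "(\<xi> \<oplus>\<^bsub>L0 M\<^esub> \<eta>) \<otimes>\<^bsub>L0 M\<^esub> \<zeta> = \<xi> \<otimes>\<^bsub>L0 M\<^esub> \<zeta> \<oplus>\<^bsub>L0 M\<^esub> \<eta> \<otimes>\<^bsub>L0 M\<^esub> \<zeta>"
    using f by (simp add: eq L0_class_ops distrib_right)
qed

lemma L0_module: "Module.module (L0 M) (L0 M :: (('w \<Rightarrow> 'k::{real_normed_field, euclidean_space}) set, _) module)"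
proof -
  interpret cring "L0 M :: (('w \<Rightarrow> 'k) set, _) module" by (rule L0_cring)
  have "smult (L0 M :: (('w \<Rightarrow> 'k) set, _) module) = mult (L0 M)" by (simp add: L0_def)
  then show ?thesis
    by (intro moduleI is_cring abelian_group_axioms) (auto simp: l_distr r_distr m_assoc)
qed

lemma L0_le_class:
  assumes "f \<in> borel_measurable M" "g \<in> borel_measurable M"
  shows "L0_le M (L0_class M f) (L0_class M g) \<longleftrightarrow> (AE w in M. f w \<le> g w)"
  unfolding L0_le_def using L0_rep_class[OF assms(1)] L0_rep_class[OF assms(2)]
  by (intro eventually_cong) auto

lemma L0_partial_order: "partial_order (L0_plus M)"
proof
  fix \<xi> \<eta> assume "\<xi> \<in> carrier (L0_plus M)" "\<eta> \<in> carrier (L0_plus M)"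
    and le: "\<xi> \<sqsubseteq>\<^bsub>L0_plus M\<^esub> \<eta>" "\<eta> \<sqsubseteq>\<^bsub>L0_plus M\<^esub> \<xi>"
  then have c: "\<xi> \<in> carrier (L0 M)" "\<eta> \<in> carrier (L0 M)" by (auto simp: L0_plus_def)
  have "AE w in M. L0_rep \<xi> w = L0_rep \<eta> w"
    using le[unfolded L0_plus_def L0_le_def, simplified] by eventually_elim simp
  then have "L0_class M (L0_rep \<xi>) = L0_class M (L0_rep \<eta>)" by (rule L0_class_cong)
  with c show "\<xi> .=\<^bsub>L0_plus M\<^esub> \<eta>" by (simp add: L0_plus_def L0_class_rep)
next
  fix \<xi> \<eta> \<zeta> assume "\<xi> \<sqsubseteq>\<^bsub>L0_plus M\<^esub> \<eta>" "\<eta> \<sqsubseteq>\<^bsub>L0_plus M\<^esub> \<zeta>"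
  then have "AE w in M. L0_rep \<xi> w \<le> L0_rep \<eta> w" "AE w in M. L0_rep \<eta> w \<le> L0_rep \<zeta> w"
    by (simp_all add: L0_plus_def L0_le_def)
  then have "AE w in M. L0_rep \<xi> w \<le> L0_rep \<zeta> w" by eventually_elim simp
  then show "\<xi> \<sqsubseteq>\<^bsub>L0_plus M\<^esub> \<zeta>" by (simp add: L0_plus_def L0_le_def)
qed (auto simp: L0_plus_def L0_le_def)

lemma L0_plus_rep_nonneg:
  assumes "\<xi> \<in> carrier (L0_plus M)"
  shows "AE w in M. 0 \<le> L0_rep \<xi> w"
proof -
  have "AE w in M. L0_rep \<zero>\<^bsub>L0 M\<^esub> w \<le> L0_rep \<xi> w"
    using assms by (simp add: L0_plus_def L0_le_def)
  moreover have "AE w in M. L0_rep (\<zero>\<^bsub>L0 M\<^esub>) w = (0::real)"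
    unfolding L0_zero by (rule L0_rep_class) simp
  ultimately show ?thesis by eventually_elim simp
qed

lemma L0_plus_class: "f \<in> borel_measurable M \<Longrightarrow> AE w in M. 0 \<le> f w \<Longrightarrow> L0_class M f \<in> carrier (L0_plus M)"
  by (simp add: L0_plus_def L0_zero L0_le_class L0_class_closed)

lemma L0_abs_class:
  fixes f :: "'w \<Rightarrow> 'k::{real_normed_field, euclidean_space}"
  assumes "f \<in> borel_measurable M"
  shows "L0_abs M (L0_class M f) = L0_class M (\<lambda>w. norm (f w))"
  unfolding L0_abs_def by (rule L0_class_cong) (use L0_rep_class[OF assms] in eventually_elim, simp)

lemma L0_abs_seminorm:
  "L0_seminorm M (L0 M :: (('w \<Rightarrow> 'k::{real_normed_field, euclidean_space}) set, _) module) (L0_abs M)"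
  unfolding L0_seminorm_def
proof (intro conjI ballI Pi_I)
  fix \<xi> \<eta> :: "('w \<Rightarrow> 'k) set"
  assume "\<xi> \<in> carrier (L0 M)" "\<eta> \<in> carrier (L0 M)"
  then obtain f g where f: "f \<in> borel_measurable M" "g \<in> borel_measurable M"
    and eq: "\<xi> = L0_class M f" "\<eta> = L0_class M g"
    by (metis L0_cases)
  show "L0_abs M (\<xi> \<odot>\<^bsub>L0 M\<^esub> \<eta>) = L0_abs M \<xi> \<otimes>\<^bsub>L0 M\<^esub> L0_abs M \<eta>"
    using f by (simp add: eq L0_class_ops L0_abs_class norm_mult)
  show "L0_le M (L0_abs M (\<xi> \<oplus>\<^bsub>L0 M\<^esub> \<eta>)) (L0_abs M \<xi> \<oplus>\<^bsub>L0 M\<^esub> L0_abs M \<eta>)"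
    using f by (simp add: eq L0_class_ops L0_abs_class L0_le_class norm_triangle_ineq)
next
  fix \<xi> :: "('w \<Rightarrow> 'k) set"
  assume "\<xi> \<in> carrier (L0 M)"
  then obtain f where "f \<in> borel_measurable M" "\<xi> = L0_class M f" by (rule L0_cases)
  then show "L0_abs M \<xi> \<in> carrier (L0_plus M)" by (simp add: L0_abs_class L0_plus_class)
qed

lemma measurable_Max_rep:
  assumes "finite S" "S \<subseteq> carrier (L0 M)"
  shows "(\<lambda>w. Max (insert 0 ((\<lambda>\<xi>. L0_rep \<xi> w) ` S)) :: real) \<in> borel_measurable M"
  using assms
proof (induction S rule: finite_induct)
  case (insert \<xi> S)
  have "Max (insert 0 ((\<lambda>\<eta>. L0_rep \<eta> w) ` insert \<xi> S))
      = max (L0_rep \<xi> w) (Max (insert 0 ((\<lambda>\<eta>. L0_rep \<eta> w) ` S)))" for w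
    using insert.hyps by (simp add: insert_commute[of 0])
  moreover have "L0_rep \<xi> \<in> borel_measurable M" using insert.prems by (intro L0_rep_measurable) simp
  moreover have "(\<lambda>w. Max (insert 0 ((\<lambda>\<xi>. L0_rep \<xi> w) ` S))) \<in> borel_measurable M"
    using insert by simp
  ultimately show ?case by (simp only: borel_measurable_max)
qed simp

lemma L0_plus_finite_sup:
  assumes S: "finite S" "S \<subseteq> carrier (L0_plus M)"
  defines "u \<equiv> L0_class M (\<lambda>w. Max (insert 0 ((\<lambda>\<xi>. L0_rep \<xi> w) ` S)))"
  shows "is_lub (L0_plus M) u S" and "\<Squnion>\<^bsub>L0_plus M\<^esub> S = u"
proof -
  let ?h = "\<lambda>w. Max (insert 0 ((\<lambda>\<xi>. L0_rep \<xi> w) ` S))"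
  have S': "S \<subseteq> carrier (L0 M)" using S(2) by (auto simp: L0_plus_def)
  have m: "?h \<in> borel_measurable M" by (rule measurable_Max_rep[OF S(1) S'])
  have ge: "?h w \<ge> 0" for w using S(1) by simp
  have u: "u \<in> carrier (L0_plus M)" unfolding u_def using ge by (intro L0_plus_class m) simp
  have rep: "AE w in M. L0_rep u w = ?h w" unfolding u_def by (rule L0_rep_class[OF m])
  have upper: "L0_le M \<xi> u" if "\<xi> \<in> S" for \<xi>
    unfolding L0_le_def using rep by eventually_elim (use S(1) that in simp)
  have least: "L0_le M u \<eta>" if "\<eta> \<in> carrier (L0_plus M)" "\<And>\<xi>. \<xi> \<in> S \<Longrightarrow> L0_le M \<xi> \<eta>" for \<eta>
  proof -
    have "AE w in M. \<forall>\<xi>\<in>S. L0_rep \<xi> w \<le> L0_rep \<eta> w"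
      using that(2) S(1) by (intro AE_finite_allI) (auto simp: L0_le_def)
    with rep L0_plus_rep_nonneg[OF that(1)] show ?thesis
      unfolding L0_le_def by eventually_elim (use S(1) in simp)
  qed
  show lub: "is_lub (L0_plus M) u S"
    unfolding least_def
  proof (intro conjI ballI)
    show "u \<in> Upper (L0_plus M) S" using u upper by (auto simp: Upper_def L0_plus_def)
    fix \<eta> assume "\<eta> \<in> Upper (L0_plus M) S"
    then have "\<eta> \<in> carrier (L0_plus M)" "\<And>\<xi>. \<xi> \<in> S \<Longrightarrow> L0_le M \<xi> \<eta>"
      using S(2) by (auto simp: Upper_def L0_plus_def)
    then have "L0_le M u \<eta>" by (rule least)
    then show "u \<sqsubseteq>\<^bsub>L0_plus M\<^esub> \<eta>" by (simp add: L0_plus_def)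
  qed (simp add: Upper_def)
  interpret partial_order "L0_plus M" by (rule L0_partial_order)
  show "\<Squnion>\<^bsub>L0_plus M\<^esub> S = u"
    unfolding sup_def by (rule some_equality[where P="\<lambda>x. is_lub (L0_plus M) x S", OF lub]) (rule least_unique[OF _ lub])
qed

lemma translation_istopology:
  assumes "\<And>U V. U \<in> \<B> \<Longrightarrow> V \<in> \<B> \<Longrightarrow> \<exists>W\<in>\<B>. W \<subseteq> U \<inter> V"
  shows "istopology (\<lambda>U. U \<subseteq> carrier E \<and> (\<forall>x\<in>U. \<exists>V\<in>\<B>. (\<lambda>v. x \<oplus>\<^bsub>E\<^esub> v) ` V \<subseteq> U))"
    (is "istopology (\<lambda>U. U \<subseteq> carrier E \<and> (\<forall>x\<in>U. ?nhd x U))")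
  unfolding istopology_def
proof (intro conjI allI impI ballI)
  fix S T x
  assume "S \<subseteq> carrier E \<and> (\<forall>x\<in>S. ?nhd x S)" "T \<subseteq> carrier E \<and> (\<forall>x\<in>T. ?nhd x T)"
    and "x \<in> S \<inter> T"
  then obtain V W where VW: "V \<in> \<B>" "W \<in> \<B>"
    "(\<lambda>v. x \<oplus>\<^bsub>E\<^esub> v) ` V \<subseteq> S" "(\<lambda>v. x \<oplus>\<^bsub>E\<^esub> v) ` W \<subseteq> T"
    by blast
  from assms[OF VW(1,2)] obtain Z where "Z \<in> \<B>" "Z \<subseteq> V \<inter> W" by blast
  moreover from this(2) VW(3,4) have "(\<lambda>v. x \<oplus>\<^bsub>E\<^esub> v) ` Z \<subseteq> S \<inter> T"
    by (auto simp: image_subset_iff)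
  ultimately show "?nhd x (S \<inter> T)" by (rule_tac bexI)
next
  fix K x
  assume K: "\<forall>U\<in>K. U \<subseteq> carrier E \<and> (\<forall>x\<in>U. ?nhd x U)" and "x \<in> \<Union>K"
  then obtain U where U: "U \<in> K" "x \<in> U" by blast
  with K obtain V where "V \<in> \<B>" "(\<lambda>v. x \<oplus>\<^bsub>E\<^esub> v) ` V \<subseteq> U" by meson
  moreover from this(2) U(1) have "(\<lambda>v. x \<oplus>\<^bsub>E\<^esub> v) ` V \<subseteq> \<Union>K"
    by (meson Union_upper order_trans)
  ultimately show "?nhd x (\<Union>K)" by (rule_tac bexI)
next
  fix K
  assume "\<forall>U\<in>K. U \<subseteq> carrier E \<and> (\<forall>x\<in>U. ?nhd x U)"
  then show "\<Union>K \<subseteq> carrier E" by (simp add: Sup_le_iff)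
qed (simp add: le_infI1)

lemma sup_seminorm_eq:
  assumes "finite Q" "\<And>p. p \<in> Q \<Longrightarrow> p \<in> carrier E \<rightarrow> carrier (L0_plus M)" "x \<in> carrier E"
  shows "sup_seminorm M Q x = L0_class M (\<lambda>w. Max (insert 0 ((\<lambda>p. L0_rep (p x) w) ` Q)))"
    and "sup_seminorm M Q x \<in> carrier (L0_plus M)"
proof -
  have S: "finite ((\<lambda>p. p x) ` Q)" "(\<lambda>p. p x) ` Q \<subseteq> carrier (L0_plus M)"
    using assms by auto
  show "sup_seminorm M Q x = L0_class M (\<lambda>w. Max (insert 0 ((\<lambda>p. L0_rep (p x) w) ` Q)))"
    unfolding sup_seminorm_def using L0_plus_finite_sup(2)[OF S] by (simp add: image_image)
  show "sup_seminorm M Q x \<in> carrier (L0_plus M)"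
    unfolding sup_seminorm_def using L0_plus_finite_sup[OF S] by (simp add: least_def Upper_def)
qed

lemma sup_seminorm_mono:
  assumes "finite R" "\<And>p. p \<in> R \<Longrightarrow> p \<in> carrier E \<rightarrow> carrier (L0_plus M)" "x \<in> carrier E" "Q \<subseteq> R"
  shows "L0_le M (sup_seminorm M Q x) (sup_seminorm M R x)"
proof -
  have Q: "finite Q" "\<And>p. p \<in> Q \<Longrightarrow> p \<in> carrier E \<rightarrow> carrier (L0_plus M)"
    using assms finite_subset by auto
  have S: "finite ((\<lambda>p. p x) ` R)" "(\<lambda>p. p x) ` R \<subseteq> carrier (L0_plus M)"
       "finite ((\<lambda>p. p x) ` Q)" "(\<lambda>p. p x) ` Q \<subseteq> carrier (L0_plus M)"
    using assms Q by auto
  have "is_lub (L0_plus M) (sup_seminorm M R x) ((\<lambda>p. p x) ` R)"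
       "is_lub (L0_plus M) (sup_seminorm M Q x) ((\<lambda>p. p x) ` Q)"
    unfolding sup_seminorm_def using L0_plus_finite_sup[OF S(1,2)] L0_plus_finite_sup[OF S(3,4)] by simp_all
  then have "sup_seminorm M R x \<in> Upper (L0_plus M) ((\<lambda>p. p x) ` Q)"
    "\<forall>u\<in>Upper (L0_plus M) ((\<lambda>p. p x) ` Q). sup_seminorm M Q x \<sqsubseteq>\<^bsub>L0_plus M\<^esub> u"
    using assms(4) by (auto simp: least_def Upper_def)
  then have "sup_seminorm M Q x \<sqsubseteq>\<^bsub>L0_plus M\<^esub> sup_seminorm M R x" by blast
  then show ?thesis by (simp add: L0_plus_def)
qed

lemma openin_L0_convex_topology:
  assumes P: "\<And>p. p \<in> P \<Longrightarrow> p \<in> carrier E \<rightarrow> carrier (L0_plus M)"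
  shows "openin (L0_convex_topology M E P) U \<longleftrightarrow>
    U \<subseteq> carrier E \<and> (\<forall>x\<in>U. \<exists>V\<in>L0_convex_base M E P. (\<lambda>v. x \<oplus>\<^bsub>E\<^esub> v) ` V \<subseteq> U)"
  unfolding L0_convex_topology_def translation_topology_def
proof (subst topology_inverse'[OF translation_istopology])
  fix V W assume "V \<in> L0_convex_base M E P" "W \<in> L0_convex_base M E P"
  then obtain Q \<epsilon> R \<delta> where V: "V = {x \<in> carrier E. L0_le M (sup_seminorm M Q x) \<epsilon>}"
    and W: "W = {x \<in> carrier E. L0_le M (sup_seminorm M R x) \<delta>}"
    and Q: "finite Q" "Q \<subseteq> P" "\<epsilon> \<in> L0_pp M" and R: "finite R" "R \<subseteq> P" "\<delta> \<in> L0_pp M"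
    unfolding L0_convex_base_def by blast
  define \<eta> where "\<eta> = L0_class M (\<lambda>w. min (L0_rep \<epsilon> w) (L0_rep \<delta> w))"
  have m: "(\<lambda>w. min (L0_rep \<epsilon> w) (L0_rep \<delta> w)) \<in> borel_measurable M"
    using Q R by (intro borel_measurable_min L0_rep_measurable) (simp_all add: L0_pp_def)
  have rep: "AE w in M. L0_rep \<eta> w = min (L0_rep \<epsilon> w) (L0_rep \<delta> w)"
    unfolding \<eta>_def by (rule L0_rep_class[OF m])
  have "AE w in M. 0 < L0_rep \<epsilon> w" "AE w in M. 0 < L0_rep \<delta> w" using Q R by (auto simp: L0_pp_def)
  with rep have "AE w in M. 0 < L0_rep \<eta> w" by eventually_elim simp
  then have \<eta>: "\<eta> \<in> L0_pp M" unfolding L0_pp_def using L0_class_closed[OF m] by (simp add: \<eta>_def)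
  let ?Z = "{x \<in> carrier E. L0_le M (sup_seminorm M (Q \<union> R) x) \<eta>}"
  have "?Z \<in> L0_convex_base M E P" unfolding L0_convex_base_def using Q R \<eta> by blast
  moreover have "?Z \<subseteq> V \<inter> W"
  proof
    fix x assume x: "x \<in> ?Z"
    have "L0_le M (sup_seminorm M Q x) (sup_seminorm M (Q \<union> R) x)"
      "L0_le M (sup_seminorm M R x) (sup_seminorm M (Q \<union> R) x)"
      by (rule sup_seminorm_mono[of _ E]; use x Q R P in blast)+
    moreover have "L0_le M (sup_seminorm M (Q \<union> R) x) \<eta>" using x by simp
    ultimately have "AE w in M. L0_rep (sup_seminorm M Q x) w \<le> L0_rep \<epsilon> w \<and> L0_rep (sup_seminorm M R x) w \<le> L0_rep \<delta> w"
      using rep unfolding L0_le_def by eventually_elim simp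
    with x show "x \<in> V \<inter> W" by (auto simp: V W L0_le_def elim: eventually_mono)
  qed
  ultimately show "\<exists>Z\<in>L0_convex_base M E P. Z \<subseteq> V \<inter> W" by blast
qed simp

lemma openin_eps_lambda_topology:
  assumes "prob_space M" and P: "\<And>p. p \<in> P \<Longrightarrow> p \<in> carrier E \<rightarrow> carrier (L0_plus M)"
  shows "openin (eps_lambda_topology M E P) U \<longleftrightarrow>
    U \<subseteq> carrier E \<and> (\<forall>x\<in>U. \<exists>V\<in>eps_lambda_base M E P. (\<lambda>v. x \<oplus>\<^bsub>E\<^esub> v) ` V \<subseteq> U)"
  unfolding eps_lambda_topology_def translation_topology_def
proof (subst topology_inverse'[OF translation_istopology])
  interpret prob_space M by fact
  fix V W assume "V \<in> eps_lambda_base M E P" "W \<in> eps_lambda_base M E P"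
  then obtain Q \<epsilon> \<kappa> R \<delta> \<mu> where
    V: "V = {x \<in> carrier E. measure M {w \<in> space M. L0_rep (sup_seminorm M Q x) w < \<epsilon>} > 1 - \<kappa>}"
    and W: "W = {x \<in> carrier E. measure M {w \<in> space M. L0_rep (sup_seminorm M R x) w < \<delta>} > 1 - \<mu>}"
    and Q: "finite Q" "Q \<subseteq> P" "0 < \<epsilon>" "0 < \<kappa>" "\<kappa> < 1" and R: "finite R" "R \<subseteq> P" "0 < \<delta>" "0 < \<mu>" "\<mu> < 1"
    unfolding eps_lambda_base_def by blast
  let ?Z = "{x \<in> carrier E. measure M {w \<in> space M. L0_rep (sup_seminorm M (Q \<union> R) x) w < min \<epsilon> \<delta>} > 1 - min \<kappa> \<mu>}"
  have "finite (Q \<union> R)" "Q \<union> R \<subseteq> P" "0 < min \<epsilon> \<delta>" "0 < min \<kappa> \<mu>" "min \<kappa> \<mu> < 1" using Q R by auto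
  then have "?Z \<in> eps_lambda_base M E P" unfolding eps_lambda_base_def by blast
  moreover have "?Z \<subseteq> V \<inter> W"
  proof
    fix x assume x: "x \<in> ?Z"
    have m: "L0_rep (sup_seminorm M S x) \<in> borel_measurable M" if "S \<subseteq> Q \<union> R" for S
    proof -
      have "finite S" "S \<subseteq> P" using that Q R finite_subset[OF that] by auto
      then have "sup_seminorm M S x \<in> carrier (L0_plus M)"
        using x P by (intro sup_seminorm_eq(2)[of _ E]) auto
      then show ?thesis by (intro L0_rep_measurable) (simp add: L0_plus_def)
    qed
    have "L0_le M (sup_seminorm M Q x) (sup_seminorm M (Q \<union> R) x)"
      "L0_le M (sup_seminorm M R x) (sup_seminorm M (Q \<union> R) x)"
      by (rule sup_seminorm_mono[of _ E]; use x Q R P in blast)+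
    then have ae: "AE w in M. L0_rep (sup_seminorm M (Q \<union> R) x) w < min \<epsilon> \<delta> \<longrightarrow> L0_rep (sup_seminorm M Q x) w < \<epsilon>"
      "AE w in M. L0_rep (sup_seminorm M (Q \<union> R) x) w < min \<epsilon> \<delta> \<longrightarrow> L0_rep (sup_seminorm M R x) w < \<delta>"
      unfolding L0_le_def by (eventually_elim, simp)+
    have s: "{w \<in> space M. L0_rep (sup_seminorm M S x) w < e} \<in> sets M" if "S \<subseteq> Q \<union> R" for S e
      using m[OF that] by measurable
    have "measure M {w \<in> space M. L0_rep (sup_seminorm M (Q \<union> R) x) w < min \<epsilon> \<delta>}
       \<le> measure M {w \<in> space M. L0_rep (sup_seminorm M Q x) w < \<epsilon>}"
       "measure M {w \<in> space M. L0_rep (sup_seminorm M (Q \<union> R) x) w < min \<epsilon> \<delta>}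
       \<le> measure M {w \<in> space M. L0_rep (sup_seminorm M R x) w < \<delta>}"
      by (rule finite_measure_mono_AE; use ae s in \<open>auto elim: eventually_mono\<close>)+
    with x show "x \<in> V \<inter> W" by (auto simp: V W)
  qed
  ultimately show "\<exists>Z\<in>eps_lambda_base M E P. Z \<subseteq> V \<inter> W" by blast
qed simp

lemma cc_seminorm_nonneg:
  assumes "measurable_partition M A" "\<And>n. finite (Q n)" "x \<in> carrier E"
    "\<And>n p. p \<in> Q n \<Longrightarrow> p \<in> carrier E \<rightarrow> carrier (L0_plus M)"
  shows "cc_seminorm M A Q x \<in> carrier (L0_plus M)"
    and "AE w in M. \<forall>n. w \<in> A n \<longrightarrow> L0_rep (cc_seminorm M A Q x) w = L0_rep (sup_seminorm M (Q n) x) w"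
proof -
  let ?g = "\<lambda>w. \<Sum>n. indicator (A n) w * L0_rep (sup_seminorm M (Q n) x) w"
  have A[measurable]: "A n \<in> sets M" for n using assms(1) by (simp add: measurable_partition_def)
  have c: "sup_seminorm M (Q n) x \<in> carrier (L0_plus M)" for n
    using assms by (intro sup_seminorm_eq(2)[of _ E]) auto
  then have [measurable]: "L0_rep (sup_seminorm M (Q n) x) \<in> borel_measurable M" for n
    by (intro L0_rep_measurable) (auto simp: L0_plus_def)
  have m: "?g \<in> borel_measurable M" by measurable
  have eq: "?g w = L0_rep (sup_seminorm M (Q n) x) w" if "w \<in> A n" for w n
  proof -
    have "w \<notin> A k" if "k \<noteq> n" for k
      using assms(1) \<open>w \<in> A n\<close> that by (auto simp: measurable_partition_def disjoint_family_on_def)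
    then have "?g w = (\<Sum>k\<in>{n}. indicator (A k) w * L0_rep (sup_seminorm M (Q k) x) w)"
      by (intro suminf_finite) auto
    with that show ?thesis by simp
  qed
  have "AE w in M. \<forall>n. 0 \<le> L0_rep (sup_seminorm M (Q n) x) w"
    using L0_plus_rep_nonneg[OF c] by (simp add: AE_all_countable)
  with AE_space have "AE w in M. 0 \<le> ?g w"
  proof eventually_elim
    case (elim w)
    then obtain n where "w \<in> A n" using assms(1) by (auto simp: measurable_partition_def)
    with elim eq show ?case by simp
  qed
  then show "cc_seminorm M A Q x \<in> carrier (L0_plus M)"
    unfolding cc_seminorm_def by (rule L0_plus_class[OF m])
  show "AE w in M. \<forall>n. w \<in> A n \<longrightarrow> L0_rep (cc_seminorm M A Q x) w = L0_rep (sup_seminorm M (Q n) x) w"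
    unfolding cc_seminorm_def using L0_rep_class[OF m] by eventually_elim (use eq in auto)
qed

end

theory Submission
  imports Defs
begin

text \<open>
  Call a homomorphism \<open>f\<close> locally bounded if there are a countable partition \<open>A n\<close>, finite sets
  \<open>Q n\<close> of seminorms and a random variable \<open>c\<close> with \<open>\<bar>f x\<bar> \<le> c * \<parallel>x\<parallel>\<close> on \<open>A n\<close>, the norm being the
  one of \<open>Q n\<close>. All three spaces consist of the locally bounded homomorphisms.

  Continuity for the locally \<open>L0\<close>-convex topology means \<open>\<bar>f x\<bar> \<le> c * \<parallel>x\<parallel>\<close> for a single finite set of
  seminorms, by scaling \<open>x\<close> with \<open>e / (\<parallel>x\<parallel> + 1/n)\<close>. This settles the second and the third space,
  since finitely many partitions have a common refinement.

  If \<open>f\<close> is continuous for the \<open>(\<epsilon>, \<lambda>)\<close>-topology, then for every \<open>l > 0\<close> there are a finite set of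
  seminorms and a real \<open>e > 0\<close> such that \<open>\<parallel>x\<parallel> \<le> e\<close> implies \<open>P(\<bar>f x\<bar> \<ge> 1) \<le> l\<close>. Concatenating vectors
  shows that the sets \<open>{\<bar>f x\<bar> \<ge> 1}\<close> with \<open>\<parallel>x\<parallel> \<le> e\<close> are closed under finite unions, so their essential
  union has probability at most \<open>l\<close>, and off it \<open>\<bar>f x\<bar> \<le> \<parallel>x\<parallel> / e\<close> by scaling. Letting \<open>l\<close> tend to
  \<open>0\<close> exhausts the sample space up to a null set.
\<close>

section \<open>Pointwise calculus in L0\<close>

text \<open>A class is recovered from its representative, so identities in \<open>L0 M\<close>
  reduce to pointwise ones almost everywhere.\<close>

lemma L0_eqI:
  assumes "\<xi> \<in> carrier (L0 M)" "\<eta> \<in> carrier (L0 M)" "AE w in M. L0_rep \<xi> w = L0_rep \<eta> w"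
  shows "\<xi> = \<eta>"
  using L0_class_cong[OF assms(3)] assms(1,2) by (simp add: L0_class_rep)

lemma L0_rep_ops:
  fixes \<xi> \<eta> :: "('w \<Rightarrow> 'k::{real_normed_field, euclidean_space}) set"
  assumes "\<xi> \<in> carrier (L0 M)" "\<eta> \<in> carrier (L0 M)"
  shows "AE w in M. L0_rep (\<xi> \<oplus>\<^bsub>L0 M\<^esub> \<eta>) w = L0_rep \<xi> w + L0_rep \<eta> w"
    and "AE w in M. L0_rep (\<xi> \<otimes>\<^bsub>L0 M\<^esub> \<eta>) w = L0_rep \<xi> w * L0_rep \<eta> w"
    and "AE w in M. L0_rep (\<xi> \<odot>\<^bsub>L0 M\<^esub> \<eta>) w = L0_rep \<xi> w * L0_rep \<eta> w"
proof -
  have [measurable]: "L0_rep \<xi> \<in> borel_measurable M" "L0_rep \<eta> \<in> borel_measurable M"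
    using assms by (auto intro: L0_rep_measurable)
  show "AE w in M. L0_rep (\<xi> \<oplus>\<^bsub>L0 M\<^esub> \<eta>) w = L0_rep \<xi> w + L0_rep \<eta> w"
    "AE w in M. L0_rep (\<xi> \<otimes>\<^bsub>L0 M\<^esub> \<eta>) w = L0_rep \<xi> w * L0_rep \<eta> w"
    "AE w in M. L0_rep (\<xi> \<odot>\<^bsub>L0 M\<^esub> \<eta>) w = L0_rep \<xi> w * L0_rep \<eta> w"
    by (simp_all add: L0_def L0_rep_class)
qed

lemma L0_ops_closed:
  fixes \<xi> \<eta> :: "('w \<Rightarrow> 'k::{real_normed_field, euclidean_space}) set"
  assumes "\<xi> \<in> carrier (L0 M)" "\<eta> \<in> carrier (L0 M)"
  shows "\<xi> \<oplus>\<^bsub>L0 M\<^esub> \<eta> \<in> carrier (L0 M)" "\<xi> \<otimes>\<^bsub>L0 M\<^esub> \<eta> \<in> carrier (L0 M)"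
    "\<xi> \<odot>\<^bsub>L0 M\<^esub> \<eta> \<in> carrier (L0 M)"
proof -
  have [measurable]: "L0_rep \<xi> \<in> borel_measurable M" "L0_rep \<eta> \<in> borel_measurable M"
    using assms by (auto intro: L0_rep_measurable)
  show "\<xi> \<oplus>\<^bsub>L0 M\<^esub> \<eta> \<in> carrier (L0 M)" "\<xi> \<otimes>\<^bsub>L0 M\<^esub> \<eta> \<in> carrier (L0 M)"
    "\<xi> \<odot>\<^bsub>L0 M\<^esub> \<eta> \<in> carrier (L0 M)"
    unfolding L0_carrier by (simp_all add: L0_def)
qed

lemma L0_rep_abs:
  fixes \<xi> :: "('w \<Rightarrow> 'k::{real_normed_field, euclidean_space}) set"
  assumes "\<xi> \<in> carrier (L0 M)"
  shows "AE w in M. L0_rep (L0_abs M \<xi>) w = norm (L0_rep \<xi> w)"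
  unfolding L0_abs_def using L0_rep_measurable[OF assms] by (intro L0_rep_class) simp

lemma L0_abs_closed:
  fixes \<xi> :: "('w \<Rightarrow> 'k::{real_normed_field, euclidean_space}) set"
  shows "\<xi> \<in> carrier (L0 M) \<Longrightarrow> L0_abs M \<xi> \<in> carrier (L0_plus M)"
  using L0_abs_seminorm[of M] by (auto simp: L0_seminorm_def)

text \<open>A base neighbourhood in \<open>L0 M\<close> may come from the empty set of seminorms,
  where the supremum is 0. Hence there is only an inequality for general \<open>R\<close>, and
  equality once \<open>R\<close> contains the absolute value.\<close>

lemma sup_abs_rep:
  fixes \<xi> :: "('w \<Rightarrow> 'k::{real_normed_field, euclidean_space}) set"
  assumes "\<xi> \<in> carrier (L0 M)" "R \<subseteq> {L0_abs M}"
  shows "AE w in M. L0_rep (sup_seminorm M R \<xi>) w \<le> norm (L0_rep \<xi> w)"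
    and "R = {L0_abs M} \<Longrightarrow> AE w in M. L0_rep (sup_seminorm M R \<xi>) w = norm (L0_rep \<xi> w)"
proof -
  have R: "finite R" "\<And>p. p \<in> R \<Longrightarrow> p \<in> carrier (L0 M) \<rightarrow> carrier (L0_plus M)"
    using assms(2) by (auto intro: finite_subset L0_abs_closed)
  have S: "(\<lambda>p. p \<xi>) ` R \<subseteq> carrier (L0 M)" using R(2) assms(1) by (auto simp: L0_plus_def)
  have "(\<lambda>w. Max (insert 0 ((\<lambda>p. L0_rep (p \<xi>) w) ` R))) \<in> borel_measurable M"
    using measurable_Max_rep[OF _ S] R(1) by (simp add: image_image)
  moreover have "sup_seminorm M R \<xi> = L0_class M (\<lambda>w. Max (insert 0 ((\<lambda>p. L0_rep (p \<xi>) w) ` R)))"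
    by (rule sup_seminorm_eq(1)[OF R(1) _ assms(1)]) (rule R(2))
  ultimately have ae: "AE w in M. L0_rep (sup_seminorm M R \<xi>) w = Max (insert 0 ((\<lambda>p. L0_rep (p \<xi>) w) ` R))"
    by (simp only: L0_rep_class)
  with L0_rep_abs[OF assms(1)]
  show "AE w in M. L0_rep (sup_seminorm M R \<xi>) w \<le> norm (L0_rep \<xi> w)"
    by eventually_elim (use assms(2) in \<open>auto simp: subset_singleton_iff\<close>)
  from ae L0_rep_abs[OF assms(1)]
  show "AE w in M. L0_rep (sup_seminorm M R \<xi>) w = norm (L0_rep \<xi> w)" if "R = {L0_abs M}"
    by eventually_elim (auto simp: that)
qed

lemma L0_rep_zero: "AE w in M. L0_rep (\<zero>\<^bsub>L0 M\<^esub> :: ('w \<Rightarrow> 'k::real_normed_field) set) w = 0"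
  unfolding L0_zero by (rule L0_rep_class) simp

lemma L0_rep_ind:
  "A \<in> sets M \<Longrightarrow> AE w in M. L0_rep (L0_ind M A :: ('w \<Rightarrow> 'k::real_normed_field) set) w = indicator A w"
  unfolding L0_ind_def by (intro L0_rep_class) simp

lemma L0_ind_closed:
  "A \<in> sets M \<Longrightarrow> (L0_ind M A :: ('w \<Rightarrow> 'k::real_normed_field) set) \<in> carrier (L0 M)"
  unfolding L0_ind_def by (intro L0_class_closed) simp

lemma L0_hom_carrier: "f \<in> L0_hom M E \<Longrightarrow> x \<in> carrier E \<Longrightarrow> f x \<in> carrier (L0 M)"
  by (auto simp: L0_hom_def)

lemma L0_hom_rep_smult:
  fixes f :: "'e \<Rightarrow> ('w \<Rightarrow> 'k::{real_normed_field, euclidean_space}) set"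
  assumes "f \<in> L0_hom M E" "x \<in> carrier E" "\<xi> \<in> carrier (L0 M)"
  shows "AE w in M. L0_rep (f (\<xi> \<odot>\<^bsub>E\<^esub> x)) w = L0_rep \<xi> w * L0_rep (f x) w"
  using assms L0_rep_ops(3)[of \<xi> M "f x"] by (auto simp: L0_hom_def PiE_iff)


section \<open>Continuity for translation topologies\<close>

text \<open>The topology enters only through its open sets, so one proof serves both topologies. The
  carrier is open because translates of any base member stay inside it.\<close>

lemma topspace_translation:
  assumes T: "\<And>U. openin T U \<longleftrightarrow> U \<subseteq> carrier E \<and> (\<forall>x\<in>U. \<exists>V\<in>\<B>. (\<lambda>v. x \<oplus>\<^bsub>E\<^esub> v) ` V \<subseteq> U)"
    and \<B>: "\<B> \<noteq> {}" "\<And>V. V \<in> \<B> \<Longrightarrow> V \<subseteq> carrier E"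
    and closed: "\<And>x y. x \<in> carrier E \<Longrightarrow> y \<in> carrier E \<Longrightarrow> x \<oplus>\<^bsub>E\<^esub> y \<in> carrier E"
  shows "topspace T = carrier E"
proof -
  have "openin T (carrier E)"
    unfolding T
  proof (intro conjI ballI)
    fix x assume x: "x \<in> carrier E"
    obtain V where "V \<in> \<B>" using \<B>(1) by auto
    moreover from this \<B>(2) x closed have "(\<lambda>v. x \<oplus>\<^bsub>E\<^esub> v) ` V \<subseteq> carrier E" by blast
    ultimately show "\<exists>V\<in>\<B>. (\<lambda>v. x \<oplus>\<^bsub>E\<^esub> v) ` V \<subseteq> carrier E" by (rule bexI[rotated])
  qed simp
  then have "carrier E \<subseteq> topspace T" by (rule openin_subset)
  moreover have "topspace T \<subseteq> carrier E" using iffD1[OF T openin_topspace] by (rule conjunct1)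
  ultimately show ?thesis by (rule subset_antisym[rotated])
qed

text \<open>Additivity carries continuity at zero to every point: if \<open>f\<close> maps
  \<open>V\<close> into \<open>W\<close>, it maps \<open>x + V\<close> into
  \<open>f x + W\<close>.\<close>

lemma continuous_map_translation:
  assumes T: "\<And>U. openin T U \<longleftrightarrow> U \<subseteq> carrier E \<and> (\<forall>x\<in>U. \<exists>V\<in>\<B>. (\<lambda>v. x \<oplus>\<^bsub>E\<^esub> v) ` V \<subseteq> U)"
    and T': "\<And>U. openin T' U \<longleftrightarrow> U \<subseteq> carrier F \<and> (\<forall>y\<in>U. \<exists>W\<in>\<C>. (\<lambda>v. y \<oplus>\<^bsub>F\<^esub> v) ` W \<subseteq> U)"
    and top: "topspace T = carrier E" "topspace T' = carrier F"
    and \<B>: "\<And>V. V \<in> \<B> \<Longrightarrow> V \<subseteq> carrier E"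
    and closed: "\<And>x y. x \<in> carrier E \<Longrightarrow> y \<in> carrier E \<Longrightarrow> x \<oplus>\<^bsub>E\<^esub> y \<in> carrier E"
    and f: "f \<in> carrier E \<rightarrow> carrier F"
      "\<And>x y. x \<in> carrier E \<Longrightarrow> y \<in> carrier E \<Longrightarrow> f (x \<oplus>\<^bsub>E\<^esub> y) = f x \<oplus>\<^bsub>F\<^esub> f y"
    and nhd: "\<And>W. W \<in> \<C> \<Longrightarrow> \<exists>V\<in>\<B>. f ` V \<subseteq> W"
  shows "continuous_map T T' f"
  unfolding continuous_map_def top
proof (intro conjI allI impI f(1))
  fix U assume U: "openin T' U"
  show "openin T {x \<in> carrier E. f x \<in> U}"
    unfolding T
  proof (intro conjI ballI)
    fix x assume x: "x \<in> {x \<in> carrier E. f x \<in> U}"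
    then have "\<exists>W\<in>\<C>. (\<lambda>v. f x \<oplus>\<^bsub>F\<^esub> v) ` W \<subseteq> U"
      using bspec[OF conjunct2[OF iffD1[OF T' U]], of "f x"] by simp
    then obtain W where W: "W \<in> \<C>" "(\<lambda>v. f x \<oplus>\<^bsub>F\<^esub> v) ` W \<subseteq> U" by (rule bexE)
    from nhd[OF W(1)] obtain V where V: "V \<in> \<B>" "f ` V \<subseteq> W" by blast
    have "(\<lambda>v. x \<oplus>\<^bsub>E\<^esub> v) ` V \<subseteq> {x \<in> carrier E. f x \<in> U}"
    proof (rule image_subsetI)
      fix v assume v: "v \<in> V"
      then have "v \<in> carrier E" "f x \<oplus>\<^bsub>F\<^esub> f v \<in> U" using \<B>[OF V(1)] V(2) W(2) by auto
      then show "x \<oplus>\<^bsub>E\<^esub> v \<in> {x \<in> carrier E. f x \<in> U}" using x closed f(2) by simp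
    qed
    with V(1) show "\<exists>V\<in>\<B>. (\<lambda>v. x \<oplus>\<^bsub>E\<^esub> v) ` V \<subseteq> {x \<in> carrier E. f x \<in> U}" by blast
  qed simp
qed


section \<open>An essential union\<close>

text \<open>An exhaustion argument: choose members whose probabilities approach the supremum
  \<open>s\<close> and let \<open>C\<close> be their union. The finite unions are members, so
  \<open>C\<close> inherits the bound; a member not almost contained in \<open>C\<close> would push
  some union above \<open>s\<close>.\<close>

lemma (in prob_space) essential_union:
  assumes meas: "\<D> \<subseteq> sets M" and ne: "\<D> \<noteq> {}"
    and un: "\<And>D D'. D \<in> \<D> \<Longrightarrow> D' \<in> \<D> \<Longrightarrow> D \<union> D' \<in> \<D>"
    and bound: "\<And>D. D \<in> \<D> \<Longrightarrow> prob D \<le> l"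
  obtains C where "C \<in> sets M" "prob C \<le> l" "\<And>D. D \<in> \<D> \<Longrightarrow> AE w in M. w \<in> D \<longrightarrow> w \<in> C"
proof -
  define s where "s = (SUP D\<in>\<D>. prob D)"
  have bdd: "bdd_above (prob ` \<D>)" by (intro bdd_aboveI[of _ 1]) auto
  have le_s: "prob D \<le> s" if "D \<in> \<D>" for D
    unfolding s_def using that bdd by (rule cSUP_upper)
  have "\<exists>D\<in>\<D>. s - 1 / Suc k < prob D" for k :: nat
    using less_cSUP_iff[OF ne bdd, of "s - 1 / Suc k"] unfolding s_def by simp
  then obtain D where D: "\<And>k. D k \<in> \<D>" "\<And>k. s - 1 / Suc k < prob (D k)" by metis
  define U where "U n = (\<Union>k\<le>n. D k)" for n
  have U: "U n \<in> \<D>" for n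
  proof (induction n)
    case (Suc n)
    have "U (Suc n) = U n \<union> D (Suc n)" by (auto simp: U_def atMost_Suc)
    then show ?case using un[OF Suc D(1)] by simp
  qed (simp add: U_def D)
  have inc: "incseq U" by (force simp: incseq_def U_def)
  have Um: "U n \<in> sets M" for n using U meas by blast
  then have C: "(\<Union>n. U n) \<in> sets M" by (intro sets.countable_UN) auto
  have lim: "(\<lambda>n. prob (U n)) \<longlonglongrightarrow> prob (\<Union>n. U n)"
    by (rule finite_Lim_measure_incseq) (use Um inc in auto)
  show ?thesis
  proof (rule that[OF C])
    show "prob (\<Union>n. U n) \<le> l" by (rule LIMSEQ_le_const2[OF lim]) (use bound U in blast)
    fix F assume F: "F \<in> \<D>"
    then have F': "F \<in> sets M" using meas by auto
    \<comment> \<open>\<open>F \<union> D k\<close> is again a member, so its probability is at most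
      \<open>s\<close>, while \<open>D k\<close> falls short of \<open>s\<close> by less than
      \<open>1 / Suc k\<close>.\<close>
    have "prob (F - (\<Union>n. U n)) \<le> 1 / Suc k" for k
    proof -
      have Dk: "D k \<in> sets M" using D meas by auto
      have "D k \<subseteq> (\<Union>n. U n)" by (auto simp: U_def)
      then have "prob (F - (\<Union>n. U n)) \<le> prob (F - D k)"
        using F' Dk by (intro finite_measure_mono) auto
      also have "\<dots> = prob (F \<union> D k) - prob (D k)"
        using F' Dk finite_measure_Union[of "F - D k" "D k"]
        by (simp add: Un_Diff_cancel2 Diff_disjoint Int_commute[of "F - D k"])
      also have "\<dots> \<le> 1 / Suc k" using le_s[OF un[OF F D(1)[of k]]] D(2)[of k] by simp
      finally show ?thesis .
    qed
    then have "prob (F - (\<Union>n. U n)) \<le> 0"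
      using LIMSEQ_le_const[OF LIMSEQ_inverse_real_of_nat] by (simp add: inverse_eq_divide)
    then have "prob (F - (\<Union>n. U n)) = 0" by (simp add: measure_le_0_iff)
    then have "AE w in M. w \<notin> F - (\<Union>n. U n)"
      using F' C by (subst prob_eq_0[symmetric]) auto
    then show "AE w in M. w \<in> F \<longrightarrow> w \<in> (\<Union>n. U n)" by eventually_elim simp
  qed
qed


section \<open>Homogeneous families\<close>

text \<open>
  Neighbourhoods are translates, and vectors are only ever scaled or concatenated along a partition.
  Hence homogeneity is the only property of the seminorms that enters, and it is the only one to be
  verified for the concatenated seminorms.
\<close>

locale L0_homogeneous_family = prob_space M + E: Module.module "L0 M" E
  for M :: "'w measure"
    and E :: "(('w \<Rightarrow> 'k::{real_normed_field, euclidean_space}) set, 'e) module" +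
  fixes P :: "('e \<Rightarrow> ('w \<Rightarrow> real) set) set"
  assumes P_closed: "p \<in> P \<Longrightarrow> p \<in> carrier E \<rightarrow> carrier (L0_plus M)"
    and P_smult: "p \<in> P \<Longrightarrow> \<xi> \<in> carrier (L0 M) \<Longrightarrow> x \<in> carrier E \<Longrightarrow>
      p (\<xi> \<odot>\<^bsub>E\<^esub> x) = L0_abs M \<xi> \<otimes>\<^bsub>L0 M\<^esub> p x"
begin

section \<open>Representatives of finite suprema of seminorms\<close>

abbreviation sn :: "('e \<Rightarrow> ('w \<Rightarrow> real) set) set \<Rightarrow> 'e \<Rightarrow> 'w \<Rightarrow> real" where
  "sn Q x \<equiv> L0_rep (sup_seminorm M Q x)"

context
  fixes Q assumes Q: "finite Q" "Q \<subseteq> P"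
begin

lemma sup_seminorm_closed: "x \<in> carrier E \<Longrightarrow> sup_seminorm M Q x \<in> carrier (L0_plus M)"
  using Q P_closed by (intro sup_seminorm_eq(2)) auto

lemma sn_measurable: "x \<in> carrier E \<Longrightarrow> sn Q x \<in> borel_measurable M"
  using sup_seminorm_closed by (intro L0_rep_measurable) (auto simp: L0_plus_def)

lemma sn_nonneg: "x \<in> carrier E \<Longrightarrow> AE w in M. 0 \<le> sn Q x w"
  using sup_seminorm_closed by (rule L0_plus_rep_nonneg)

text \<open>The abstract supremum is computed by a pointwise maximum. The inserted 0 gives the empty
  set its supremum in \<open>L0_plus M\<close> and does not alter the others almost everywhere, all
  values being nonnegative.\<close>

lemma sn_eq_Max:
  assumes "x \<in> carrier E"
  shows "AE w in M. sn Q x w = Max (insert 0 ((\<lambda>p. L0_rep (p x) w) ` Q))"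
proof -
  have Q': "\<And>p. p \<in> Q \<Longrightarrow> p \<in> carrier E \<rightarrow> carrier (L0_plus M)" using Q P_closed by auto
  have S: "(\<lambda>p. p x) ` Q \<subseteq> carrier (L0 M)" using Q' assms by (auto simp: L0_plus_def)
  have "(\<lambda>w. Max (insert 0 ((\<lambda>p. L0_rep (p x) w) ` Q))) \<in> borel_measurable M"
    using measurable_Max_rep[OF _ S] Q(1) by (simp add: image_image)
  moreover have "sup_seminorm M Q x = L0_class M (\<lambda>w. Max (insert 0 ((\<lambda>p. L0_rep (p x) w) ` Q)))"
    by (rule sup_seminorm_eq(1)[OF Q(1) _ assms]) (rule Q')
  ultimately show ?thesis by (simp only: L0_rep_class)
qed

lemma sn_smult:
  assumes x: "x \<in> carrier E" and \<xi>: "\<xi> \<in> carrier (L0 M)"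
  shows "AE w in M. sn Q (\<xi> \<odot>\<^bsub>E\<^esub> x) w = norm (L0_rep \<xi> w) * sn Q x w"
proof -
  have sx: "\<xi> \<odot>\<^bsub>E\<^esub> x \<in> carrier E" using \<xi> x by (rule E.smult_closed)
  have "AE w in M. \<forall>p\<in>Q. L0_rep (p (\<xi> \<odot>\<^bsub>E\<^esub> x)) w = norm (L0_rep \<xi> w) * L0_rep (p x) w"
  proof (intro AE_finite_allI Q(1))
    fix p assume "p \<in> Q"
    then have p: "p \<in> P" using Q by auto
    then have px: "p x \<in> carrier (L0 M)" using P_closed x by (auto simp: L0_plus_def)
    have a: "L0_abs M \<xi> \<in> carrier (L0 M)" using L0_abs_closed[OF \<xi>] by (simp add: L0_plus_def)
    show "AE w in M. L0_rep (p (\<xi> \<odot>\<^bsub>E\<^esub> x)) w = norm (L0_rep \<xi> w) * L0_rep (p x) w"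
      unfolding P_smult[OF p \<xi> x]
      using L0_rep_ops(2)[OF a px] L0_rep_abs[OF \<xi>] by eventually_elim simp
  qed
  then show ?thesis
    using sn_eq_Max[OF x] sn_eq_Max[of "\<xi> \<odot>\<^bsub>E\<^esub> x", OF sx]
  proof eventually_elim
    case (elim w)
    let ?c = "norm (L0_rep \<xi> w)"
    \<comment> \<open>Multiplication by a nonnegative number is monotone, hence commutes with the
      maximum; it fixes the inserted 0.\<close>
    have "mono ((*) ?c)" by (intro monoI mult_left_mono) auto
    then have "?c * Max (insert 0 ((\<lambda>p. L0_rep (p x) w) ` Q))
      = Max ((*) ?c ` insert 0 ((\<lambda>p. L0_rep (p x) w) ` Q))"
      using Q(1) by (intro mono_Max_commute) auto
    also have "(*) ?c ` insert 0 ((\<lambda>p. L0_rep (p x) w) ` Q)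
      = insert 0 ((\<lambda>p. L0_rep (p (\<xi> \<odot>\<^bsub>E\<^esub> x)) w) ` Q)"
      using elim(1) by (auto simp: image_iff)
    finally show ?case using elim by simp
  qed
qed

end

lemma sn_mono:
  assumes "finite R" "R \<subseteq> P" "Q \<subseteq> R" "x \<in> carrier E"
  shows "AE w in M. sn Q x w \<le> sn R x w"
proof -
  have "L0_le M (sup_seminorm M Q x) (sup_seminorm M R x)"
    by (rule sup_seminorm_mono[of R E]) (use assms P_closed in blast)+
  then show ?thesis by (simp add: L0_le_def)
qed

lemma hom_rep_add:
  assumes "f \<in> L0_hom M E" "x \<in> carrier E" "y \<in> carrier E"
  shows "AE w in M. L0_rep (f (x \<oplus>\<^bsub>E\<^esub> y)) w = L0_rep (f x) w + L0_rep (f y) w"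
  using assms L0_rep_ops(1)[of "f x" M "f y"] by (auto simp: L0_hom_def PiE_iff)

lemma hom_rep_measurable:
  "f \<in> L0_hom M E \<Longrightarrow> x \<in> carrier E \<Longrightarrow> L0_rep (f x) \<in> borel_measurable M"
  by (intro L0_rep_measurable L0_hom_carrier)

lemma hom_zero:
  assumes f: "f \<in> L0_hom M E"
  shows "f \<zero>\<^bsub>E\<^esub> = \<zero>\<^bsub>L0 M\<^esub>"
proof (rule L0_eqI)
  show "f \<zero>\<^bsub>E\<^esub> \<in> carrier (L0 M)" using f by (rule L0_hom_carrier) simp
  show "\<zero>\<^bsub>L0 M\<^esub> \<in> carrier (L0 M)" by (simp add: L0_zero L0_class_closed)
  have "AE w in M. L0_rep (f (\<zero>\<^bsub>E\<^esub> \<oplus>\<^bsub>E\<^esub> \<zero>\<^bsub>E\<^esub>)) w = L0_rep (f \<zero>\<^bsub>E\<^esub>) w + L0_rep (f \<zero>\<^bsub>E\<^esub>) w"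
    using f by (rule hom_rep_add) simp_all
  then show "AE w in M. L0_rep (f \<zero>\<^bsub>E\<^esub>) w = L0_rep \<zero>\<^bsub>L0 M\<^esub> w"
    using L0_rep_zero[where ?'k = 'k] by eventually_elim simp
qed

section \<open>Base neighbourhoods and continuity at the null element\<close>

lemma openin_L0_convex:
  "openin (L0_convex_topology M E P) U \<longleftrightarrow>
    U \<subseteq> carrier E \<and> (\<forall>x\<in>U. \<exists>V\<in>L0_convex_base M E P. (\<lambda>v. x \<oplus>\<^bsub>E\<^esub> v) ` V \<subseteq> U)"
  by (rule openin_L0_convex_topology) (rule P_closed)

lemma openin_eps_lambda:
  "openin (eps_lambda_topology M E P) U \<longleftrightarrow>
    U \<subseteq> carrier E \<and> (\<forall>x\<in>U. \<exists>V\<in>eps_lambda_base M E P. (\<lambda>v. x \<oplus>\<^bsub>E\<^esub> v) ` V \<subseteq> U)"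
  by (rule openin_eps_lambda_topology[OF prob_space_axioms]) (rule P_closed)

lemma L0_convex_base_carrier: "V \<in> L0_convex_base M E P \<Longrightarrow> V \<subseteq> carrier E"
  by (auto simp: L0_convex_base_def)

lemma eps_lambda_base_carrier: "V \<in> eps_lambda_base M E P \<Longrightarrow> V \<subseteq> carrier E"
  by (auto simp: eps_lambda_base_def)

lemma topspace_L0_convex: "topspace (L0_convex_topology M E P) = carrier E"
proof (rule topspace_translation[OF openin_L0_convex])
  \<comment> \<open>The empty set of seminorms with the constant radius 1 gives a base
    member.\<close>
  have "AE w in M. L0_rep (L0_class M (\<lambda>w. 1::real)) w = 1" by (rule L0_rep_class) simp
  then have "AE w in M. 0 < L0_rep (L0_class M (\<lambda>w. 1::real)) w" by eventually_elim simp
  then have "L0_class M (\<lambda>w. 1) \<in> L0_pp M" by (simp add: L0_pp_def L0_class_closed)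
  then show "L0_convex_base M E P \<noteq> {}"
    unfolding L0_convex_base_def by (blast intro: finite.emptyI empty_subsetI)
qed (auto dest: L0_convex_base_carrier)

lemma topspace_eps_lambda: "topspace (eps_lambda_topology M E P) = carrier E"
proof (rule topspace_translation[OF openin_eps_lambda])
  have "(0::real) < 1/2" "(1::real)/2 < 1" by auto
  then show "eps_lambda_base M E P \<noteq> {}"
    unfolding eps_lambda_base_def by (blast intro: finite.emptyI empty_subsetI)
qed (auto dest: eps_lambda_base_carrier)

text \<open>The preimage of an open set around 0 is open and contains the null element, hence
  contains a base member. An open \<open>U\<close> is demanded because base members are not shown to
  be open; the two unit balls below supply it.\<close>

lemma continuous_at_zero:
  assumes f: "f \<in> L0_hom M E" and cont: "continuous_map T T' f"
    and U: "openin T' U" "\<zero>\<^bsub>L0 M\<^esub> \<in> U"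
    and top: "topspace T = carrier E"
    and T: "\<And>U. openin T U \<longleftrightarrow> U \<subseteq> carrier E \<and> (\<forall>x\<in>U. \<exists>V\<in>\<B>. (\<lambda>v. x \<oplus>\<^bsub>E\<^esub> v) ` V \<subseteq> U)"
    and \<B>: "\<And>V. V \<in> \<B> \<Longrightarrow> V \<subseteq> carrier E"
  obtains V where "V \<in> \<B>" "f ` V \<subseteq> U"
proof -
  have "openin T {x \<in> carrier E. f x \<in> U}"
    using openin_continuous_map_preimage[OF cont U(1)] top by simp
  moreover have "\<zero>\<^bsub>E\<^esub> \<in> {x \<in> carrier E. f x \<in> U}" using hom_zero[OF f] U(2) by simp
  ultimately obtain V where V: "V \<in> \<B>" "(\<lambda>v. \<zero>\<^bsub>E\<^esub> \<oplus>\<^bsub>E\<^esub> v) ` V \<subseteq> {x \<in> carrier E. f x \<in> U}"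
    using T by meson
  have "f ` V \<subseteq> U"
  proof (rule image_subsetI)
    fix v assume "v \<in> V"
    with V \<B>[OF V(1)] have "v \<in> carrier E" "f (\<zero>\<^bsub>E\<^esub> \<oplus>\<^bsub>E\<^esub> v) \<in> U" by auto
    then show "f v \<in> U" by simp
  qed
  with V(1) show ?thesis by (rule that)
qed

text \<open>Apply the unit bound to \<open>x\<close> scaled by \<open>e / (sn Q x + 1/(n+1))\<close>
  and let \<open>n\<close> tend to infinity. The predicate \<open>R\<close> confines the estimate to
  a part of the sample space: it is trivial for the locally \<open>L0\<close>-convex topology and
  cuts off an exceptional event for the (\<epsilon>, \<lambda>)-topology.\<close>

lemma hom_bound_by_scaling:
  assumes f: "f \<in> L0_hom M E" and Q: "finite Q" "Q \<subseteq> P"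
    and e: "e \<in> borel_measurable M" "AE w in M. 0 < e w"
    and bound: "\<And>x. x \<in> carrier E \<Longrightarrow> AE w in M. sn Q x w \<le> e w \<Longrightarrow>
      AE w in M. R w \<longrightarrow> norm (L0_rep (f x) w) \<le> 1"
    and x: "x \<in> carrier E"
  shows "AE w in M. R w \<longrightarrow> norm (L0_rep (f x) w) \<le> inverse (e w) * sn Q x w"
proof -
  note [measurable] = e(1) sn_measurable[OF Q x]
  have "AE w in M. R w \<longrightarrow> e w * norm (L0_rep (f x) w) \<le> sn Q x w + inverse (real (Suc n))" for n
  proof -
    \<comment> \<open>The added \<open>inverse (real (Suc n))\<close> keeps the divisor positive
      where the seminorm vanishes.\<close>
    define g :: "'w \<Rightarrow> 'k" where "g w = of_real (e w / (sn Q x w + inverse (real (Suc n))))" for w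
    have gm: "g \<in> borel_measurable M" unfolding g_def by measurable
    define \<xi> where "\<xi> = L0_class M g"
    have \<xi>: "\<xi> \<in> carrier (L0 M)" unfolding \<xi>_def using gm by (rule L0_class_closed)
    have rep: "AE w in M. L0_rep \<xi> w = g w" unfolding \<xi>_def using gm by (rule L0_rep_class)
    have g: "norm (g w) = e w / (sn Q x w + inverse (real (Suc n)))"
      if "0 \<le> sn Q x w" "0 < e w" for w
      unfolding g_def norm_of_real using that by simp
    have \<xi>x: "\<xi> \<odot>\<^bsub>E\<^esub> x \<in> carrier E" using \<xi> x by (rule E.smult_closed)
    have "AE w in M. sn Q (\<xi> \<odot>\<^bsub>E\<^esub> x) w \<le> e w"
      using sn_smult[OF Q x \<xi>] rep sn_nonneg[OF Q x] e(2)
    proof eventually_elim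
      case (elim w)
      have "0 < sn Q x w + inverse (real (Suc n))" using elim by (simp add: add_nonneg_pos)
      then have "e w / (sn Q x w + inverse (real (Suc n))) * sn Q x w \<le> e w"
        using elim(4) by (simp add: pos_divide_le_eq mult_left_mono)
      with elim g show ?case by simp
    qed
    from bound[OF \<xi>x this] L0_hom_rep_smult[OF f x \<xi>] rep sn_nonneg[OF Q x] e(2)
    show ?thesis
    proof eventually_elim
      case (elim w)
      have "0 < sn Q x w + inverse (real (Suc n))" using elim by (simp add: add_nonneg_pos)
      with elim g[of w] show ?case by (auto simp: norm_mult pos_divide_le_eq)
    qed
  qed
  \<comment> \<open>The countably many exceptional null sets are collected first, so that the limit
    can be taken at each remaining point.\<close>
  then have "AE w in M. \<forall>n. R w \<longrightarrow> e w * norm (L0_rep (f x) w) \<le> sn Q x w + inverse (real (Suc n))"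
    by (intro AE_all_countable[THEN iffD2] allI)
  with e(2) show ?thesis
  proof eventually_elim
    case (elim w)
    show ?case
    proof
      assume "R w"
      with elim(2) have "e w * norm (L0_rep (f x) w) \<le> sn Q x w + inverse (real (Suc n))" for n
        by blast
      moreover have "(\<lambda>n. sn Q x w + inverse (real (Suc n))) \<longlonglongrightarrow> sn Q x w"
        using LIMSEQ_inverse_real_of_nat_add[of "sn Q x w"] by simp
      ultimately have "e w * norm (L0_rep (f x) w) \<le> sn Q x w"
        by (intro LIMSEQ_le_const) auto
      then show "norm (L0_rep (f x) w) \<le> inverse (e w) * sn Q x w"
        using elim(1) by (simp add: field_simps)
    qed
  qed
qed

end

text \<open>The scalars form such a family themselves, so the topological facts of the locale also
  apply to the target of a homomorphism.\<close>

lemma L0_homogeneous_abs: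
  assumes "prob_space M"
  shows "L0_homogeneous_family M (L0 M :: (('w \<Rightarrow> 'k::{real_normed_field, euclidean_space}) set, _) module)
    {L0_abs M}"
  using assms L0_module[of M] L0_abs_seminorm[of M]
  by (auto simp: L0_homogeneous_family_def L0_homogeneous_family_axioms_def L0_seminorm_def)

section \<open>Continuity for the locally \<open>L0\<close>-convex topology as a bound by one finite
  supremum\<close>

context L0_homogeneous_family
begin

text \<open>Around \<open>\<eta>\<close> a random radius proportional to
  \<open>1 - norm \<eta>\<close> is admissible, since it is strictly positive almost everywhere; no
  constant radius need exist.\<close>

lemma open_L0_convex_unit_ball:
  "openin (L0_convex_topology M (L0 M :: (('w \<Rightarrow> 'k) set, _) module) {L0_abs M})
    {\<eta> \<in> carrier (L0 M). AE w in M. norm (L0_rep \<eta> w) < 1}" (is "openin _ ?U")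
  unfolding L0_homogeneous_family.openin_L0_convex[OF L0_homogeneous_abs[OF prob_space_axioms]]
proof (intro conjI ballI)
  fix \<eta> :: "('w \<Rightarrow> 'k) set" assume \<eta>: "\<eta> \<in> ?U"
  \<comment> \<open>Half the gap: base neighbourhoods are defined by a non-strict inequality, and
    the full gap would only yield norm at most 1.\<close>
  define g where "g w = (1 - norm (L0_rep \<eta> w)) / 2" for w
  have [measurable]: "L0_rep \<eta> \<in> borel_measurable M" using \<eta> by (intro L0_rep_measurable) simp
  have gm: "g \<in> borel_measurable M" unfolding g_def by measurable
  have rep: "AE w in M. L0_rep (L0_class M g) w = g w" using gm by (rule L0_rep_class)
  have \<eta>1: "AE w in M. norm (L0_rep \<eta> w) < 1" using \<eta> by simp
  with rep have "AE w in M. 0 < L0_rep (L0_class M g) w" by eventually_elim (simp add: g_def)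
  then have pp: "L0_class M g \<in> L0_pp M" using gm by (simp add: L0_pp_def L0_class_closed)
  let ?W = "{v \<in> carrier (L0 M :: (('w \<Rightarrow> 'k) set, _) module).
    L0_le M (sup_seminorm M {L0_abs M} v) (L0_class M g)}"
  have W: "?W \<in> L0_convex_base M (L0 M) {L0_abs M}"
    unfolding L0_convex_base_def using pp by blast
  have "(\<lambda>v. \<eta> \<oplus>\<^bsub>L0 M\<^esub> v) ` ?W \<subseteq> ?U"
  proof (rule image_subsetI)
    fix v assume v: "v \<in> ?W"
    then have vc: "v \<in> carrier (L0 M)" and
      le: "AE w in M. L0_rep (sup_seminorm M {L0_abs M} v) w \<le> L0_rep (L0_class M g) w"
      by (auto simp: L0_le_def)
    have \<eta>c: "\<eta> \<in> carrier (L0 M)" using \<eta> by simp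
    have "AE w in M. norm (L0_rep (\<eta> \<oplus>\<^bsub>L0 M\<^esub> v) w) < 1"
      using L0_rep_ops(1)[OF \<eta>c vc] le sup_abs_rep(2)[OF vc order_refl refl] rep \<eta>1
    proof eventually_elim
      case (elim w)
      have "norm (L0_rep \<eta> w + L0_rep v w) \<le> norm (L0_rep \<eta> w) + g w"
        using elim norm_triangle_ineq[of "L0_rep \<eta> w" "L0_rep v w"] by simp
      also have "\<dots> < 1" using elim by (simp add: g_def field_simps)
      finally show ?case using elim by simp
    qed
    then show "\<eta> \<oplus>\<^bsub>L0 M\<^esub> v \<in> ?U" using L0_ops_closed(1)[OF \<eta>c vc] by simp
  qed
  with W show "\<exists>W\<in>L0_convex_base M (L0 M) {L0_abs M}. (\<lambda>v. \<eta> \<oplus>\<^bsub>L0 M\<^esub> v) ` W \<subseteq> ?U" by blast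
qed auto

text \<open>A base neighbourhood of radius \<open>\<epsilon>\<close> is mapped into the open unit
  ball; scaling gives the bound with \<open>c = 1 / \<epsilon>\<close>.\<close>

lemma dual_c_imp_bound:
  assumes f: "f \<in> dual_c M E P"
  obtains Q c where "finite Q" "Q \<subseteq> P" "c \<in> borel_measurable M"
    "\<And>x. x \<in> carrier E \<Longrightarrow> AE w in M. norm (L0_rep (f x) w) \<le> c w * sn Q x w"
proof -
  have hom: "f \<in> L0_hom M E"
    and cont: "continuous_map (L0_convex_topology M E P) (L0_convex_topology M (L0 M) {L0_abs M}) f"
    using f by (auto simp: dual_c_def)
  let ?U = "{\<eta> \<in> carrier (L0 M :: (('w \<Rightarrow> 'k) set, _) module). AE w in M. norm (L0_rep \<eta> w) < 1}"
  have "AE w in M. norm (L0_rep (\<zero>\<^bsub>L0 M\<^esub> :: ('w \<Rightarrow> 'k) set) w) < 1"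
    using L0_rep_zero[where ?'k = 'k] by eventually_elim simp
  then have "\<zero>\<^bsub>L0 M\<^esub> \<in> ?U" by (simp add: L0_zero L0_class_closed)
  then obtain V where V: "V \<in> L0_convex_base M E P" "f ` V \<subseteq> ?U"
    by (rule continuous_at_zero[OF hom cont open_L0_convex_unit_ball _ topspace_L0_convex
        openin_L0_convex L0_convex_base_carrier])
  then obtain Q \<epsilon> where Q: "finite Q" "Q \<subseteq> P" and \<epsilon>: "\<epsilon> \<in> L0_pp M"
    and V_eq: "V = {x \<in> carrier E. L0_le M (sup_seminorm M Q x) \<epsilon>}"
    unfolding L0_convex_base_def by blast
  have em: "L0_rep \<epsilon> \<in> borel_measurable M" "AE w in M. 0 < L0_rep \<epsilon> w"
    using \<epsilon> by (auto simp: L0_pp_def intro: L0_rep_measurable)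
  have bound: "AE w in M. True \<longrightarrow> norm (L0_rep (f x) w) \<le> 1"
    if "x \<in> carrier E" "AE w in M. sn Q x w \<le> L0_rep \<epsilon> w" for x
  proof -
    have "x \<in> V" using V_eq that by (simp add: L0_le_def)
    then have "AE w in M. norm (L0_rep (f x) w) < 1" using V(2) by blast
    then show ?thesis by eventually_elim simp
  qed
  show ?thesis
  proof (rule that[OF Q])
    show "(\<lambda>w. inverse (L0_rep \<epsilon> w)) \<in> borel_measurable M" using em by measurable
    fix x assume "x \<in> carrier E"
    then show "AE w in M. norm (L0_rep (f x) w) \<le> inverse (L0_rep \<epsilon> w) * sn Q x w"
      using hom_bound_by_scaling[OF hom Q em bound] by simp
  qed
qed

lemma bound_imp_dual_c:
  assumes f: "f \<in> L0_hom M E" and Q: "finite Q" "Q \<subseteq> P" and c: "c \<in> borel_measurable M"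
    and bound: "\<And>x. x \<in> carrier E \<Longrightarrow> AE w in M. norm (L0_rep (f x) w) \<le> c w * sn Q x w"
  shows "f \<in> dual_c M E P"
proof -
  interpret K: L0_homogeneous_family M "L0 M :: (('w \<Rightarrow> 'k) set, _) module" "{L0_abs M}"
    by (rule L0_homogeneous_abs) unfold_locales
  have "continuous_map (L0_convex_topology M E P) (L0_convex_topology M (L0 M) {L0_abs M}) f"
  proof (rule continuous_map_translation[OF openin_L0_convex K.openin_L0_convex
        topspace_L0_convex K.topspace_L0_convex L0_convex_base_carrier])
    show "f \<in> carrier E \<rightarrow> carrier (L0 M)" using f by (auto simp: L0_hom_def)
    show "f (x \<oplus>\<^bsub>E\<^esub> y) = f x \<oplus>\<^bsub>L0 M\<^esub> f y" if "x \<in> carrier E" "y \<in> carrier E" for x y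
      using f that by (auto simp: L0_hom_def)
    fix W assume "W \<in> L0_convex_base M (L0 M :: (('w \<Rightarrow> 'k) set, _) module) {L0_abs M}"
    then obtain R \<epsilon> where R: "R \<subseteq> {L0_abs M}" and \<epsilon>: "\<epsilon> \<in> L0_pp M"
      and W: "W = {x \<in> carrier (L0 M). L0_le M (sup_seminorm M R x) \<epsilon>}"
      unfolding L0_convex_base_def by blast
    have em[measurable]: "L0_rep \<epsilon> \<in> borel_measurable M" and pos: "AE w in M. 0 < L0_rep \<epsilon> w"
      using \<epsilon> by (auto simp: L0_pp_def intro: L0_rep_measurable)
    \<comment> \<open>\<open>c\<close> may be negative or vanish; \<open>\<bar>c\<bar> + 1\<close>
      dominates it and is a positive divisor, so the radius is strictly positive.\<close>
    define g where "g w = L0_rep \<epsilon> w / (\<bar>c w\<bar> + 1)" for w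
    have gm: "g \<in> borel_measurable M" unfolding g_def using c by measurable
    have rep: "AE w in M. L0_rep (L0_class M g) w = g w" using gm by (rule L0_rep_class)
    with pos have "AE w in M. 0 < L0_rep (L0_class M g) w" by eventually_elim (simp add: g_def add_nonneg_pos)
    then have pp: "L0_class M g \<in> L0_pp M" using gm by (simp add: L0_pp_def L0_class_closed)
    let ?V = "{x \<in> carrier E. L0_le M (sup_seminorm M Q x) (L0_class M g)}"
    have V: "?V \<in> L0_convex_base M E P" unfolding L0_convex_base_def using Q pp by blast
    have "f ` ?V \<subseteq> W"
    proof (rule image_subsetI)
      fix x assume x: "x \<in> ?V"
      then have xc: "x \<in> carrier E" and le: "AE w in M. sn Q x w \<le> L0_rep (L0_class M g) w"
        by (auto simp: L0_le_def)
      have fx: "f x \<in> carrier (L0 M)" using f xc by (rule L0_hom_carrier)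
      have "AE w in M. L0_rep (sup_seminorm M R (f x)) w \<le> L0_rep \<epsilon> w"
        using sup_abs_rep(1)[OF fx R] bound[OF xc] le rep sn_nonneg[OF Q xc]
      proof eventually_elim
        case (elim w)
        have "L0_rep (sup_seminorm M R (f x)) w \<le> c w * sn Q x w" using elim by simp
        also have "\<dots> \<le> (\<bar>c w\<bar> + 1) * sn Q x w" using elim by (intro mult_right_mono) auto
        also have "\<dots> \<le> (\<bar>c w\<bar> + 1) * g w" using elim by (intro mult_left_mono) auto
        also have "\<dots> = L0_rep \<epsilon> w" by (simp add: g_def)
        finally show ?case .
      qed
      with fx show "f x \<in> W" by (simp add: W L0_le_def)
    qed
    with V show "\<exists>V\<in>L0_convex_base M E P. f ` V \<subseteq> W" by blast
  qed simp_all
  with f show ?thesis by (simp add: dual_c_def)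
qed

end


section \<open>Concatenation\<close>

lemma L0_ind_mult:
  assumes "A \<in> sets M" "B \<in> sets M"
  shows "L0_ind M A \<otimes>\<^bsub>L0 M\<^esub> L0_ind M B
    = (L0_ind M (A \<inter> B) :: ('w \<Rightarrow> 'k::{real_normed_field, euclidean_space}) set)"
proof -
  have "(\<lambda>w. indicator A w * indicator B w :: 'k) = indicator (A \<inter> B)"
    by (rule ext) (simp add: indicator_inter_arith)
  with assms show ?thesis by (simp add: L0_ind_def L0_class_ops)
qed

lemma L0_ind_empty: "L0_ind M {} = \<zero>\<^bsub>L0 M\<^esub>"
  unfolding L0_ind_def L0_zero by (rule L0_class_cong) simp

text \<open>Bonferroni's inequality, used to combine two events of large probability.\<close>

lemma (in prob_space) prob_Int_ge:
  assumes "A \<in> sets M" "B \<in> sets M"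
  shows "prob A + prob B - 1 \<le> prob (A \<inter> B)"
proof -
  have "prob (A \<union> B) = prob A + prob B - prob (A \<inter> B)" using assms
    by (simp add: finite_measure_Union' finite_measure_Diff' Int_commute)
  with prob_le_1[of "A \<union> B"] show ?thesis by simp
qed

lemma partition_cover: "measurable_partition M A \<Longrightarrow> w \<in> space M \<Longrightarrow> \<exists>n. w \<in> A n"
  by (auto simp: measurable_partition_def)

lemma suminf_partition:
  fixes c :: "nat \<Rightarrow> 'w \<Rightarrow> real"
  assumes "measurable_partition M A" "w \<in> A n"
  shows "(\<Sum>k. indicator (A k) w * c k w) = c n w"
proof -
  have "w \<notin> A k" if "k \<noteq> n" for k
    using assms that by (auto simp: measurable_partition_def disjoint_family_on_def)
  then have "(\<Sum>k. indicator (A k) w * c k w) = (\<Sum>k\<in>{n}. indicator (A k) w * c k w)"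
    by (intro suminf_finite) auto
  with assms(2) show ?thesis by simp
qed

context L0_homogeneous_family
begin

text \<open>By homogeneity, the seminorms and functional values of \<open>L0_ind M A\<close> times
  \<open>z\<close> are those of \<open>z\<close> times the indicator. They therefore determine those
  of \<open>z\<close> on \<open>A\<close>.\<close>

lemma L0_ind_smult_local:
  assumes A: "A \<in> sets M" and z: "z \<in> carrier E" and x: "x \<in> carrier E"
    and eq: "L0_ind M A \<odot>\<^bsub>E\<^esub> z = L0_ind M A \<odot>\<^bsub>E\<^esub> x"
  shows "finite Q \<Longrightarrow> Q \<subseteq> P \<Longrightarrow> AE w in M. w \<in> A \<longrightarrow> sn Q z w = sn Q x w"
    and "f \<in> L0_hom M E \<Longrightarrow> AE w in M. w \<in> A \<longrightarrow> L0_rep (f z) w = L0_rep (f x) w"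
proof -
  have i: "(L0_ind M A :: ('w \<Rightarrow> 'k) set) \<in> carrier (L0 M)" using A by (rule L0_ind_closed)
  have rep: "AE w in M. L0_rep (L0_ind M A :: ('w \<Rightarrow> 'k) set) w = indicator A w"
    using A by (rule L0_rep_ind)
  show "AE w in M. w \<in> A \<longrightarrow> sn Q z w = sn Q x w" if Q: "finite Q" "Q \<subseteq> P"
    using sn_smult[OF Q z i] sn_smult[OF Q x i] rep
    by eventually_elim (auto simp: eq indicator_def split: if_splits)
  show "AE w in M. w \<in> A \<longrightarrow> L0_rep (f z) w = L0_rep (f x) w" if f: "f \<in> L0_hom M E"
    using L0_hom_rep_smult[OF f z i] L0_hom_rep_smult[OF f x i] rep
    by eventually_elim (auto simp: eq indicator_def split: if_splits)
qed

text \<open>The pasted vector is the sum of the restrictions of \<open>x\<close> to \<open>D\<close>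
  and of \<open>y\<close> to its complement. The same \<open>z\<close> serves all \<open>Q\<close>
  and all \<open>f\<close>, so its size and its image are controlled together.\<close>

lemma concatenation:
  assumes x: "x \<in> carrier E" and y: "y \<in> carrier E" and D: "D \<in> sets M"
  obtains z where "z \<in> carrier E"
    "\<And>Q. finite Q \<Longrightarrow> Q \<subseteq> P \<Longrightarrow> AE w in M. sn Q z w = (if w \<in> D then sn Q x w else sn Q y w)"
    "\<And>f. f \<in> L0_hom M E \<Longrightarrow>
      AE w in M. L0_rep (f z) w = (if w \<in> D then L0_rep (f x) w else L0_rep (f y) w)"
proof -
  let ?i = "L0_ind M D :: ('w \<Rightarrow> 'k) set" and ?j = "L0_ind M (space M - D) :: ('w \<Rightarrow> 'k) set"
  have D': "space M - D \<in> sets M" using D by auto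
  note ij = L0_ind_closed[OF D, where ?'k = 'k] L0_ind_closed[OF D', where ?'k = 'k]
  define z where "z = ?i \<odot>\<^bsub>E\<^esub> x \<oplus>\<^bsub>E\<^esub> ?j \<odot>\<^bsub>E\<^esub> y"
  have z: "z \<in> carrier E" unfolding z_def using ij x y by simp
  \<comment> \<open>The two indicators are orthogonal idempotents, so multiplying \<open>z\<close>
    by either one leaves just the corresponding summand.\<close>
  have "?i \<otimes>\<^bsub>L0 M\<^esub> ?i = ?i" "?i \<otimes>\<^bsub>L0 M\<^esub> ?j = \<zero>\<^bsub>L0 M\<^esub>" "?j \<otimes>\<^bsub>L0 M\<^esub> ?i = \<zero>\<^bsub>L0 M\<^esub>" "?j \<otimes>\<^bsub>L0 M\<^esub> ?j = ?j"
    using D D' by (simp_all add: L0_ind_mult Diff_Int_distrib2 flip: L0_ind_empty)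
  then have "?i \<odot>\<^bsub>E\<^esub> z = ?i \<odot>\<^bsub>E\<^esub> x" "?j \<odot>\<^bsub>E\<^esub> z = ?j \<odot>\<^bsub>E\<^esub> y"
    unfolding z_def using ij x y by (simp_all add: E.smult_r_distr flip: E.smult_assoc1)
  note loc = L0_ind_smult_local[OF D z x this(1)] L0_ind_smult_local[OF D' z y this(2)]
  show ?thesis
  proof (rule that[OF z])
    fix Q assume Q: "finite Q" "Q \<subseteq> P"
    show "AE w in M. sn Q z w = (if w \<in> D then sn Q x w else sn Q y w)"
      using loc(1)[OF Q] loc(3)[OF Q] AE_space by eventually_elim auto
  next
    fix f assume f: "f \<in> L0_hom M E"
    show "AE w in M. L0_rep (f z) w = (if w \<in> D then L0_rep (f x) w else L0_rep (f y) w)"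
      using loc(2)[OF f] loc(4)[OF f] AE_space by eventually_elim auto
  qed
qed


section \<open>Local boundedness\<close>

text \<open>A single \<open>c\<close> for all pieces loses nothing, since piecewise bounds can be
  glued along the partition. No sign is imposed on \<open>c\<close>, and linearity of
  \<open>f\<close> is kept as a separate condition.\<close>

definition locally_bounded :: "('e \<Rightarrow> ('w \<Rightarrow> 'k) set) \<Rightarrow> bool" where
  "locally_bounded f \<longleftrightarrow>
    (\<exists>A Q c. measurable_partition M A \<and> (\<forall>n. finite (Q n) \<and> Q n \<subseteq> P) \<and> c \<in> borel_measurable M \<and>
      (\<forall>x\<in>carrier E. AE w in M. \<forall>n. w \<in> A n \<longrightarrow> norm (L0_rep (f x) w) \<le> c w * sn (Q n) x w))"

text \<open>The series over the pieces glues the bounds \<open>c n\<close>: on \<open>A n\<close> it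
  reduces to the single term \<open>c n\<close>.\<close>

lemma locally_boundedI:
  assumes A: "measurable_partition M A" and Q: "\<And>n. finite (Q n)" "\<And>n. Q n \<subseteq> P"
    and c: "\<And>n. c n \<in> borel_measurable M"
    and bound: "\<And>n x. x \<in> carrier E \<Longrightarrow>
      AE w in M. w \<in> A n \<longrightarrow> norm (L0_rep (f x) w) \<le> c n w * sn (Q n) x w"
  shows "locally_bounded f"
proof -
  have [measurable]: "A n \<in> sets M" for n using A by (simp add: measurable_partition_def)
  have "(\<lambda>w. \<Sum>n. indicator (A n) w * c n w) \<in> borel_measurable M" using c by measurable
  moreover have "AE w in M. \<forall>n. w \<in> A n \<longrightarrow>
      norm (L0_rep (f x) w) \<le> (\<Sum>n. indicator (A n) w * c n w) * sn (Q n) x w"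
    if "x \<in> carrier E" for x
  proof -
    have "AE w in M. \<forall>n. w \<in> A n \<longrightarrow> norm (L0_rep (f x) w) \<le> c n w * sn (Q n) x w"
      using bound[OF that] by (simp add: AE_all_countable)
    then show ?thesis by eventually_elim (auto simp: suminf_partition[OF A])
  qed
  ultimately show ?thesis
    unfolding locally_bounded_def using A Q
    by (intro exI[of _ A] exI[of _ Q] exI[of _ "\<lambda>w. \<Sum>n. indicator (A n) w * c n w"]) auto
qed

text \<open>The event where the norm is below 1 is the increasing limit of the events
  \<open>X k\<close> where it stays below \<open>1 - 1/(k+1)\<close>. Some \<open>X k\<close> still
  has probability above \<open>1 - l\<close>, which leaves room for a perturbation both in size and
  in probability.\<close>

lemma open_eps_lambda_unit_ball:
  assumes l: "0 < l"
  shows "openin (eps_lambda_topology M (L0 M :: (('w \<Rightarrow> 'k) set, _) module) {L0_abs M})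
    {\<eta> \<in> carrier (L0 M). prob {w \<in> space M. norm (L0_rep \<eta> w) < 1} > 1 - l}" (is "openin _ ?U")
  unfolding L0_homogeneous_family.openin_eps_lambda[OF L0_homogeneous_abs[OF prob_space_axioms]]
proof (intro conjI ballI)
  fix \<eta> :: "('w \<Rightarrow> 'k) set" assume \<eta>: "\<eta> \<in> ?U"
  then have \<eta>c: "\<eta> \<in> carrier (L0 M)" by simp
  have [measurable]: "L0_rep \<eta> \<in> borel_measurable M" using \<eta>c by (rule L0_rep_measurable)
  define X where "X k = {w \<in> space M. norm (L0_rep \<eta> w) < 1 - inverse (real (Suc k))}" for k
  have X[measurable]: "X k \<in> sets M" for k unfolding X_def by measurable
  have "incseq X"
  proof (rule incseq_SucI)
    fix k
    have "1 - inverse (real (Suc k)) \<le> 1 - inverse (real (Suc (Suc k)))" by simp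
    then show "X k \<subseteq> X (Suc k)" unfolding X_def using less_le_trans by blast
  qed
  then have "(\<lambda>k. prob (X k)) \<longlonglongrightarrow> prob (\<Union>k. X k)"
    by (intro finite_Lim_measure_incseq) auto
  moreover have "(\<Union>k. X k) = {w \<in> space M. norm (L0_rep \<eta> w) < 1}"
  proof (intro equalityI subsetI)
    fix w assume "w \<in> {w \<in> space M. norm (L0_rep \<eta> w) < 1}"
    moreover from this obtain k where "inverse (real (Suc k)) < 1 - norm (L0_rep \<eta> w)"
      using reals_Archimedean[of "1 - norm (L0_rep \<eta> w)"] by auto
    ultimately have "w \<in> X k" by (simp add: X_def)
    then show "w \<in> (\<Union>k. X k)" by blast
  next
    fix w assume "w \<in> (\<Union>k. X k)"
    then obtain k where "w \<in> space M" "norm (L0_rep \<eta> w) < 1 - inverse (real (Suc k))"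
      by (auto simp: X_def)
    moreover have "0 < inverse (real (Suc k))" by simp
    ultimately have "w \<in> space M" "norm (L0_rep \<eta> w) < 1" by linarith+
    then show "w \<in> {w \<in> space M. norm (L0_rep \<eta> w) < 1}" by simp
  qed
  ultimately have "eventually (\<lambda>k. prob (X k) > 1 - l) sequentially"
    using \<eta> by (intro order_tendstoD(1)) auto
  then obtain k where k: "prob (X k) > 1 - l" by (auto simp: eventually_sequentially)
  \<comment> \<open>The surplus of probability is the exceptional probability allowed to a
    perturbation; the cap 1/2 meets the requirement that it be below 1.\<close>
  define d where "d = min (prob (X k) - (1 - l)) (1 / 2)"
  have d: "0 < d" "d < 1" "d \<le> prob (X k) - (1 - l)" using k by (auto simp: d_def)
  define \<epsilon> where "\<epsilon> = inverse (real (Suc k))"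
  have \<epsilon>: "0 < \<epsilon>" by (simp add: \<epsilon>_def)
  let ?W = "{v \<in> carrier (L0 M :: (('w \<Rightarrow> 'k) set, _) module).
    prob {w \<in> space M. L0_rep (sup_seminorm M {L0_abs M} v) w < \<epsilon>} > 1 - d}"
  have W: "?W \<in> eps_lambda_base M (L0 M) {L0_abs M}"
    unfolding eps_lambda_base_def using d \<epsilon> by blast
  have "(\<lambda>v. \<eta> \<oplus>\<^bsub>L0 M\<^esub> v) ` ?W \<subseteq> ?U"
  proof (rule image_subsetI)
    fix v assume v: "v \<in> ?W"
    then have vc: "v \<in> carrier (L0 M)" by simp
    have sc: "\<eta> \<oplus>\<^bsub>L0 M\<^esub> v \<in> carrier (L0 M)" using \<eta>c vc by (rule L0_ops_closed(1))
    have [measurable]: "L0_rep v \<in> borel_measurable M" "L0_rep (\<eta> \<oplus>\<^bsub>L0 M\<^esub> v) \<in> borel_measurable M"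
      using vc sc by (auto intro: L0_rep_measurable)
    interpret K: L0_homogeneous_family M "L0 M :: (('w \<Rightarrow> 'k) set, _) module" "{L0_abs M}"
      by (rule L0_homogeneous_abs) unfold_locales
    have [measurable]: "L0_rep (sup_seminorm M {L0_abs M} v) \<in> borel_measurable M"
      using vc by (intro K.sn_measurable) auto
    let ?Y = "{w \<in> space M. L0_rep (sup_seminorm M {L0_abs M} v) w < \<epsilon>}"
    have "1 - l < prob (X k) + prob ?Y - 1" using d v by simp
    also have "\<dots> \<le> prob (X k \<inter> ?Y)" by (rule prob_Int_ge) measurable
    also have "\<dots> \<le> prob {w \<in> space M. norm (L0_rep (\<eta> \<oplus>\<^bsub>L0 M\<^esub> v) w) < 1}"
    proof (rule finite_measure_mono_AE)
      show "AE w in M. w \<in> X k \<inter> ?Y \<longrightarrow> w \<in> {w \<in> space M. norm (L0_rep (\<eta> \<oplus>\<^bsub>L0 M\<^esub> v) w) < 1}"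
        using L0_rep_ops(1)[OF \<eta>c vc] sup_abs_rep(2)[OF vc order_refl refl]
      proof eventually_elim
        case (elim w)
        then show ?case
          using norm_triangle_ineq[of "L0_rep \<eta> w" "L0_rep v w"] by (auto simp: X_def \<epsilon>_def)
      qed
    qed measurable
    finally show "\<eta> \<oplus>\<^bsub>L0 M\<^esub> v \<in> ?U" using sc by simp
  qed
  with W show "\<exists>W\<in>eps_lambda_base M (L0 M) {L0_abs M}. (\<lambda>v. \<eta> \<oplus>\<^bsub>L0 M\<^esub> v) ` W \<subseteq> ?U" by blast
qed auto

text \<open>The exceptional event is the essential union of the events on which uniformly small
  vectors have large images. Off it the constant is \<open>2 / \<epsilon>\<close>.\<close>

lemma dual_eps_lambda_bound:
  assumes f: "f \<in> dual_eps_lambda M E P" and l: "0 < l"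
  obtains B Q c where "B \<in> sets M" "prob B \<ge> 1 - l" "finite Q" "Q \<subseteq> P"
    "\<And>x. x \<in> carrier E \<Longrightarrow> AE w in M. w \<in> B \<longrightarrow> norm (L0_rep (f x) w) \<le> (c::real) * sn Q x w"
proof -
  have hom: "f \<in> L0_hom M E"
    and cont: "continuous_map (eps_lambda_topology M E P) (eps_lambda_topology M (L0 M) {L0_abs M}) f"
    using f by (auto simp: dual_eps_lambda_def)
  let ?U = "{\<eta> \<in> carrier (L0 M :: (('w \<Rightarrow> 'k) set, _) module).
    prob {w \<in> space M. norm (L0_rep \<eta> w) < 1} > 1 - l}"
  have zc: "\<zero>\<^bsub>L0 M\<^esub> \<in> carrier (L0 M :: (('w \<Rightarrow> 'k) set, _) module)"
    by (simp add: L0_zero L0_class_closed)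
  then have [measurable]: "L0_rep (\<zero>\<^bsub>L0 M\<^esub> :: ('w \<Rightarrow> 'k) set) \<in> borel_measurable M"
    by (rule L0_rep_measurable)
  have "AE w in M. norm (L0_rep (\<zero>\<^bsub>L0 M\<^esub> :: ('w \<Rightarrow> 'k) set) w) < 1"
    using L0_rep_zero[where ?'k = 'k] by eventually_elim simp
  then have "prob {w \<in> space M. norm (L0_rep (\<zero>\<^bsub>L0 M\<^esub> :: ('w \<Rightarrow> 'k) set) w) < 1} = 1"
    by (subst prob_Collect_eq_1) auto
  with l zc have "\<zero>\<^bsub>L0 M\<^esub> \<in> ?U" by simp
  then obtain V where V: "V \<in> eps_lambda_base M E P" "f ` V \<subseteq> ?U"
    by (rule continuous_at_zero[OF hom cont open_eps_lambda_unit_ball[OF l] _ topspace_eps_lambda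
        openin_eps_lambda eps_lambda_base_carrier])
  then obtain Q \<epsilon> \<delta> where Q: "finite Q" "Q \<subseteq> P" and \<epsilon>: "0 < \<epsilon>" "0 < \<delta>"
    and V_eq: "V = {x \<in> carrier E. prob {w \<in> space M. sn Q x w < \<epsilon>} > 1 - \<delta>}"
    unfolding eps_lambda_base_def by blast
  \<comment> \<open>A member only has to lie inside the event where the image has norm at least 1,
    not to equal it; this lets one pasted vector witness a union. Half of \<open>\<epsilon>\<close>
    gives the strict inequality of the base neighbourhood.\<close>
  define \<D> where "\<D> = {D \<in> sets M. \<exists>x\<in>carrier E. (AE w in M. sn Q x w \<le> \<epsilon> / 2) \<and>
    (AE w in M. w \<in> D \<longrightarrow> 1 \<le> norm (L0_rep (f x) w))}"
  have small: "prob D \<le> l" if D: "D \<in> \<D>" for D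
  proof -
    obtain x where x: "x \<in> carrier E" "AE w in M. sn Q x w \<le> \<epsilon> / 2"
      "AE w in M. w \<in> D \<longrightarrow> 1 \<le> norm (L0_rep (f x) w)" and Dm[measurable]: "D \<in> sets M"
      using D by (auto simp: \<D>_def)
    note [measurable] = sn_measurable[OF Q x(1)] hom_rep_measurable[OF hom x(1)]
    \<comment> \<open>The seminorm is below \<open>\<epsilon>\<close> almost surely, so
      \<open>x\<close> lies in \<open>V\<close> whatever the value of
      \<open>\<delta>\<close>.\<close>
    have "AE w in M. sn Q x w < \<epsilon>" using x(2) by eventually_elim (use \<epsilon> in simp)
    then have "prob {w \<in> space M. sn Q x w < \<epsilon>} = 1" by (subst prob_Collect_eq_1) auto
    then have "x \<in> V" using V_eq x(1) \<epsilon> by simp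
    then have "1 - l < prob {w \<in> space M. norm (L0_rep (f x) w) < 1}" using V(2) by blast
    also have "\<dots> \<le> prob (space M - D)"
      by (rule finite_measure_mono_AE) (use x(3) in \<open>eventually_elim, auto\<close>, measurable)
    also have "\<dots> = 1 - prob D" by (rule prob_compl) measurable
    finally show ?thesis by simp
  qed
  have sub: "\<D> \<subseteq> sets M" by (auto simp: \<D>_def)
  have "{} \<in> \<D>"
  proof -
    have "\<zero>\<^bsub>E\<^esub> \<in> carrier E" by simp
    \<comment> \<open>The null vector is written as a multiple by the scalar 0, so that its seminorm
      follows from homogeneity.\<close>
    moreover from this have z: "\<zero>\<^bsub>L0 M\<^esub> \<odot>\<^bsub>E\<^esub> \<zero>\<^bsub>E\<^esub> = \<zero>\<^bsub>E\<^esub>" by (rule E.smult_l_null)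
    moreover have "AE w in M. sn Q (\<zero>\<^bsub>L0 M\<^esub> \<odot>\<^bsub>E\<^esub> \<zero>\<^bsub>E\<^esub>) w \<le> \<epsilon> / 2"
      using sn_smult[OF Q E.M.zero_closed zc] L0_rep_zero[where ?'k = 'k] by eventually_elim (use \<epsilon> in simp)
    ultimately show ?thesis by (auto simp: \<D>_def)
  qed
  then have ne: "\<D> \<noteq> {}" by blast
  have un: "D \<union> D' \<in> \<D>" if D: "D \<in> \<D>" and D': "D' \<in> \<D>" for D D'
  proof -
    obtain x where x: "x \<in> carrier E" "AE w in M. sn Q x w \<le> \<epsilon> / 2"
      "AE w in M. w \<in> D \<longrightarrow> 1 \<le> norm (L0_rep (f x) w)" and Dm: "D \<in> sets M"
      using D by (auto simp: \<D>_def)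
    obtain y where y: "y \<in> carrier E" "AE w in M. sn Q y w \<le> \<epsilon> / 2"
      "AE w in M. w \<in> D' \<longrightarrow> 1 \<le> norm (L0_rep (f y) w)" and Dm': "D' \<in> sets M"
      using D' by (auto simp: \<D>_def)
    obtain z where z: "z \<in> carrier E"
      "AE w in M. sn Q z w = (if w \<in> D then sn Q x w else sn Q y w)"
      "AE w in M. L0_rep (f z) w = (if w \<in> D then L0_rep (f x) w else L0_rep (f y) w)"
      by (rule concatenation[OF x(1) y(1) Dm]) (use Q hom in blast)
    have "AE w in M. sn Q z w \<le> \<epsilon> / 2" using z(2) x(2) y(2) by eventually_elim simp
    moreover have "AE w in M. w \<in> D \<union> D' \<longrightarrow> 1 \<le> norm (L0_rep (f z) w)"
      using z(3) x(3) y(3) by eventually_elim auto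
    ultimately show ?thesis using z(1) Dm Dm' by (auto simp: \<D>_def)
  qed
  obtain C where C: "C \<in> sets M" "prob C \<le> l"
    "\<And>D. D \<in> \<D> \<Longrightarrow> AE w in M. w \<in> D \<longrightarrow> w \<in> C"
    by (rule essential_union[OF sub ne un small that])
  have bound: "AE w in M. w \<in> space M - C \<longrightarrow> norm (L0_rep (f x) w) \<le> 1"
    if x: "x \<in> carrier E" "AE w in M. sn Q x w \<le> \<epsilon> / 2" for x
  proof -
    note [measurable] = hom_rep_measurable[OF hom x(1)]
    \<comment> \<open>The full event of large image belongs to \<open>\<D>\<close>, hence lies in
      \<open>C\<close> up to a null set.\<close>
    have "{w \<in> space M. 1 \<le> norm (L0_rep (f x) w)} \<in> \<D>" using x by (auto simp: \<D>_def)
    from C(3)[OF this] show ?thesis by eventually_elim auto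
  qed
  show ?thesis
  proof (rule that[OF _ _ Q])
    show "space M - C \<in> sets M" "prob (space M - C) \<ge> 1 - l" using C by (auto simp: prob_compl)
    fix x assume "x \<in> carrier E"
    then show "AE w in M. w \<in> space M - C \<longrightarrow> norm (L0_rep (f x) w) \<le> inverse (\<epsilon> / 2) * sn Q x w"
      using \<epsilon> bound by (intro hom_bound_by_scaling[OF hom Q, where e = "\<lambda>_. \<epsilon> / 2"]) auto
  qed
qed

text \<open>With exceptional probabilities \<open>1/(n+1)\<close> the good events \<open>B n\<close>
  cover almost everything; making them disjoint yields the partition.\<close>

lemma dual_eps_lambda_imp_locally_bounded:
  assumes f: "f \<in> dual_eps_lambda M E P"
  shows "locally_bounded f"
proof -
  define good where "good l B Q c \<longleftrightarrow> B \<in> sets M \<and> prob B \<ge> 1 - l \<and> finite Q \<and> Q \<subseteq> P \<and>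
    (\<forall>x\<in>carrier E. AE w in M. w \<in> B \<longrightarrow> norm (L0_rep (f x) w) \<le> c * sn Q x w)" for l B Q c
  have "\<exists>B Q c. good (inverse (real (Suc n))) B Q c" for n
  proof -
    have "0 < inverse (real (Suc n))" by simp
    then show ?thesis by (rule dual_eps_lambda_bound[OF f]) (unfold good_def, blast)
  qed
  then obtain B Q c where good: "\<And>n. good (inverse (real (Suc n))) (B n) (Q n) (c n)" by metis
  then have B: "\<And>n. B n \<in> sets M" "\<And>n. prob (B n) \<ge> 1 - inverse (real (Suc n))"
    and Q: "\<And>n. finite (Q n)" "\<And>n. Q n \<subseteq> P"
    and bound: "\<And>n x. x \<in> carrier E \<Longrightarrow> AE w in M. w \<in> B n \<longrightarrow> norm (L0_rep (f x) w) \<le> c n * sn (Q n) x w"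
    unfolding good_def by blast+
  have Bm: "(\<Union>n. B n) \<in> sets M" using B(1) by blast
  have "1 - inverse (real (Suc n)) \<le> prob (\<Union>n. B n)" for n
    using B(2)[of n] finite_measure_mono[OF UN_upper[of n UNIV B] Bm] by simp
  moreover have "(\<lambda>n. 1 - inverse (real (Suc n))) \<longlonglongrightarrow> 1"
    using LIMSEQ_inverse_real_of_nat_add_minus[of 1] by simp
  ultimately have "1 \<le> prob (\<Union>n. B n)" by (intro LIMSEQ_le_const2) auto
  then have "prob (\<Union>n. B n) = 1" using prob_le_1 by (intro antisym) auto
  then have full: "AE w in M. w \<in> (\<Union>n. B n)" by (rule AE_prob_1)
  \<comment> \<open>The pieces have to cover the sample space exactly, so the null complement of the
    union is added to the first event. The bound is only claimed almost everywhere.\<close>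
  define B' where "B' n = (if n = 0 then B 0 \<union> (space M - (\<Union>n. B n)) else B n)" for n :: nat
  have B'm: "B' n \<in> sets M" for n using B(1) Bm by (auto simp: B'_def)
  have "(\<Union>n. B' n) = space M"
  proof
    show "(\<Union>n. B' n) \<subseteq> space M" using B'm sets.sets_into_space by blast
    show "space M \<subseteq> (\<Union>n. B' n)"
    proof
      fix w assume w: "w \<in> space M"
      show "w \<in> (\<Union>n. B' n)"
      proof (cases "w \<in> (\<Union>n. B n)")
        case True
        then obtain n where "w \<in> B n" by blast
        then have "w \<in> B' n" by (cases "n = 0") (auto simp: B'_def)
        then show ?thesis by blast
      next
        case False
        with w have "w \<in> B' 0" by (simp add: B'_def)
        then show ?thesis by blast
      qed
    qed
  qed
  then have "measurable_partition M (disjointed B')"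
    unfolding measurable_partition_def using B'm sets.range_disjointed_sets[of B' M]
    by (auto simp: disjoint_family_disjointed UN_disjointed_eq)
  then show ?thesis
  proof (rule locally_boundedI[OF _ Q])
    show "(\<lambda>_. c n) \<in> borel_measurable M" for n by simp
    fix n x assume "x \<in> carrier E"
    from bound[OF this, of n] full
    show "AE w in M. w \<in> disjointed B' n \<longrightarrow> norm (L0_rep (f x) w) \<le> c n * sn (Q n) x w"
    proof eventually_elim
      case (elim w)
      have "w \<in> B n" if "w \<in> disjointed B' n"
        using that elim(2) disjointed_subset[of B' n] by (auto simp: B'_def split: if_splits)
      with elim(1) show ?case by blast
    qed
  qed
qed

text \<open>Up to small probability only finitely many pieces matter and \<open>c\<close> is bounded
  above; on such an event \<open>G k\<close>, one finite set of seminorms and one real constant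
  control \<open>f\<close>.\<close>

lemma locally_bounded_imp_dual_eps_lambda:
  assumes f: "f \<in> L0_hom M E" and lb: "locally_bounded f"
  shows "f \<in> dual_eps_lambda M E P"
proof -
  interpret K: L0_homogeneous_family M "L0 M :: (('w \<Rightarrow> 'k) set, _) module" "{L0_abs M}"
    by (rule L0_homogeneous_abs) unfold_locales
  obtain A Q c where A: "measurable_partition M A" and Q: "\<And>n. finite (Q n)" "\<And>n. Q n \<subseteq> P"
    and c[measurable]: "c \<in> borel_measurable M"
    and bound: "\<And>x. x \<in> carrier E \<Longrightarrow>
      AE w in M. \<forall>n. w \<in> A n \<longrightarrow> norm (L0_rep (f x) w) \<le> c w * sn (Q n) x w"
    using lb unfolding locally_bounded_def by blast
  have Am[measurable]: "A n \<in> sets M" for n using A by (simp add: measurable_partition_def)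
  define G where "G k = {w \<in> space M. (\<exists>n\<le>k. w \<in> A n) \<and> c w \<le> real k}" for k :: nat
  have G[measurable]: "G k \<in> sets M" for k unfolding G_def by measurable
  have "incseq G"
  proof (intro incseq_SucI subsetI)
    fix k w assume "w \<in> G k"
    then obtain n where n: "w \<in> space M" "n \<le> k" "w \<in> A n" "c w \<le> real k" by (auto simp: G_def)
    then have "n \<le> Suc k" "c w \<le> real (Suc k)" by auto
    with n show "w \<in> G (Suc k)" unfolding G_def by blast
  qed
  moreover have "(\<Union>k. G k) = space M"
  proof (intro equalityI subsetI)
    fix w assume w: "w \<in> space M"
    then obtain n where n: "w \<in> A n" using partition_cover[OF A] by blast
    obtain m :: nat where "c w \<le> real m" using real_arch_simple by blast
    with n w have "w \<in> G (max n m)" by (auto simp: G_def intro!: exI[of _ n])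
    then show "w \<in> (\<Union>k. G k)" by blast
  qed (auto simp: G_def)
  ultimately have lim: "(\<lambda>k. prob (G k)) \<longlonglongrightarrow> 1"
    using finite_Lim_measure_incseq[of G] G by (simp add: prob_space image_subset_iff)
  have "continuous_map (eps_lambda_topology M E P) (eps_lambda_topology M (L0 M) {L0_abs M}) f"
  proof (rule continuous_map_translation[OF openin_eps_lambda K.openin_eps_lambda
        topspace_eps_lambda K.topspace_eps_lambda eps_lambda_base_carrier])
    show "f \<in> carrier E \<rightarrow> carrier (L0 M)" using f by (auto simp: L0_hom_def)
    show "f (x \<oplus>\<^bsub>E\<^esub> y) = f x \<oplus>\<^bsub>L0 M\<^esub> f y" if "x \<in> carrier E" "y \<in> carrier E" for x y
      using f that by (auto simp: L0_hom_def)
    fix W assume "W \<in> eps_lambda_base M (L0 M :: (('w \<Rightarrow> 'k) set, _) module) {L0_abs M}"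
    then obtain R \<epsilon> \<delta> where R: "R \<subseteq> {L0_abs M}" and \<epsilon>: "0 < \<epsilon>" and \<delta>: "0 < \<delta>" "\<delta> < 1"
      and W: "W = {x \<in> carrier (L0 M). prob {w \<in> space M. L0_rep (sup_seminorm M R x) w < \<epsilon>} > 1 - \<delta>}"
      unfolding eps_lambda_base_def by blast
    \<comment> \<open>Half of \<open>\<delta>\<close> is spent on the complement of
      \<open>G k\<close>, the other half on the base neighbourhood \<open>?V\<close>.\<close>
    have "eventually (\<lambda>k. prob (G k) > 1 - \<delta> / 2) sequentially"
      using lim \<delta> by (intro order_tendstoD(1)) auto
    then obtain k where k: "prob (G k) > 1 - \<delta> / 2" by (auto simp: eventually_sequentially)
    define S where "S = (\<Union>n\<le>k. Q n)"
    have S: "finite S" "S \<subseteq> P" using Q by (auto simp: S_def)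
    \<comment> \<open>The divisor \<open>k + 1\<close> is positive also for \<open>k = 0\<close> and
      makes the final estimate strict.\<close>
    let ?e = "\<epsilon> / (real k + 1)"
    let ?V = "{x \<in> carrier E. prob {w \<in> space M. sn S x w < ?e} > 1 - \<delta> / 2}"
    have "0 < ?e" "0 < \<delta> / 2" "\<delta> / 2 < 1" using \<epsilon> \<delta> by auto
    with S have V: "?V \<in> eps_lambda_base M E P" unfolding eps_lambda_base_def by blast
    have "f ` ?V \<subseteq> W"
    proof (rule image_subsetI)
      fix x assume x: "x \<in> ?V"
      then have xc: "x \<in> carrier E" by simp
      have fx: "f x \<in> carrier (L0 M)" using f xc by (rule L0_hom_carrier)
      have Rf: "finite R" using R finite_subset by blast
      note [measurable] = sn_measurable[OF S xc] K.sn_measurable[OF Rf R fx]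
      let ?Y = "{w \<in> space M. sn S x w < ?e}"
      have "1 - \<delta> < prob (G k) + prob ?Y - 1" using x k by simp
      also have "\<dots> \<le> prob (G k \<inter> ?Y)" by (rule prob_Int_ge) measurable
      also have "\<dots> \<le> prob {w \<in> space M. L0_rep (sup_seminorm M R (f x)) w < \<epsilon>}"
      proof (rule finite_measure_mono_AE)
        have mono: "AE w in M. \<forall>n\<in>{..k}. sn (Q n) x w \<le> sn S x w"
          by (intro AE_finite_allI sn_mono S xc) (auto simp: S_def)
        have nonneg: "AE w in M. \<forall>n\<in>{..k}. 0 \<le> sn (Q n) x w"
          by (intro AE_finite_allI sn_nonneg Q xc) auto
        show "AE w in M. w \<in> G k \<inter> ?Y \<longrightarrow> w \<in> {w \<in> space M. L0_rep (sup_seminorm M R (f x)) w < \<epsilon>}"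
          using sup_abs_rep(1)[OF fx R] bound[OF xc] mono nonneg
        proof eventually_elim
          case (elim w)
          show ?case
          proof
            assume w: "w \<in> G k \<inter> ?Y"
            then obtain n where n: "n \<le> k" "w \<in> A n" "c w \<le> real k" by (auto simp: G_def)
            have "L0_rep (sup_seminorm M R (f x)) w \<le> c w * sn (Q n) x w" using elim n by force
            also have "\<dots> \<le> real k * sn (Q n) x w" using elim n by (intro mult_right_mono) auto
            also have "\<dots> \<le> real k * ?e"
              using elim n w by (intro mult_left_mono) (auto intro: order_trans less_imp_le)
            also have "\<dots> < \<epsilon>" using \<epsilon> by (simp add: field_simps)
            finally show "w \<in> {w \<in> space M. L0_rep (sup_seminorm M R (f x)) w < \<epsilon>}" using w by simp
          qed
        qed
      qed measurable
      finally show "f x \<in> W" using fx by (simp add: W)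
    qed
    with V show "\<exists>V\<in>eps_lambda_base M E P. f ` V \<subseteq> W" by blast
  qed simp_all
  with f show ?thesis by (simp add: dual_eps_lambda_def)
qed

lemma dual_eps_lambda_eq: "dual_eps_lambda M E P = {f \<in> L0_hom M E. locally_bounded f}"
  using dual_eps_lambda_imp_locally_bounded locally_bounded_imp_dual_eps_lambda
  by (auto simp: dual_eps_lambda_def)


section \<open>The concatenated family of seminorms\<close>

lemma cc_seminorm_rep:
  assumes "measurable_partition M A" "\<And>n. finite (Q n)" "\<And>n. Q n \<subseteq> P" "x \<in> carrier E"
  shows "cc_seminorm M A Q x \<in> carrier (L0_plus M)"
    and "AE w in M. \<forall>n. w \<in> A n \<longrightarrow> L0_rep (cc_seminorm M A Q x) w = sn (Q n) x w"
  using assms P_closed by (intro cc_seminorm_nonneg[where E = E]; blast)+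

text \<open>On each piece a concatenated seminorm agrees with a finite supremum, which is
  homogeneous. Thus the description of the locally \<open>L0\<close>-convex dual by bounds applies
  to \<open>cc_family M P\<close> as well.\<close>

lemma cc_homogeneous: "L0_homogeneous_family M E (cc_family M P)"
proof unfold_locales
  fix p assume "p \<in> cc_family M P"
  then obtain A Q where p: "p = cc_seminorm M A Q" and A: "measurable_partition M A"
    and Q: "\<And>n. finite (Q n)" "\<And>n. Q n \<subseteq> P"
    unfolding cc_family_def by blast
  show "p \<in> carrier E \<rightarrow> carrier (L0_plus M)" unfolding p by (intro Pi_I cc_seminorm_rep(1) A Q)
  fix \<xi> :: "('w \<Rightarrow> 'k) set" and x assume \<xi>: "\<xi> \<in> carrier (L0 M)" and x: "x \<in> carrier E"
  have \<xi>x: "\<xi> \<odot>\<^bsub>E\<^esub> x \<in> carrier E" using \<xi> x by (rule E.smult_closed)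
  have c: "p x \<in> carrier (L0 M)" "p (\<xi> \<odot>\<^bsub>E\<^esub> x) \<in> carrier (L0 M)"
    unfolding p using cc_seminorm_rep(1)[of A Q, OF A Q x] cc_seminorm_rep(1)[of A Q, OF A Q \<xi>x] by (auto simp: L0_plus_def)
  have a: "L0_abs M \<xi> \<in> carrier (L0 M)" using L0_abs_closed[OF \<xi>] by (simp add: L0_plus_def)
  show "p (\<xi> \<odot>\<^bsub>E\<^esub> x) = L0_abs M \<xi> \<otimes>\<^bsub>L0 M\<^esub> p x"
  proof (rule L0_eqI[OF c(2) L0_ops_closed(2)[OF a c(1)]])
    have "AE w in M. \<forall>n. sn (Q n) (\<xi> \<odot>\<^bsub>E\<^esub> x) w = norm (L0_rep \<xi> w) * sn (Q n) x w"
      by (intro AE_all_countable[THEN iffD2] allI sn_smult Q x \<xi>)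
    with cc_seminorm_rep(2)[of A Q, OF A Q x] cc_seminorm_rep(2)[of A Q, OF A Q \<xi>x] L0_rep_ops(2)[OF a c(1)]
      L0_rep_abs[OF \<xi>] AE_space
    show "AE w in M. L0_rep (p (\<xi> \<odot>\<^bsub>E\<^esub> x)) w = L0_rep (L0_abs M \<xi> \<otimes>\<^bsub>L0 M\<^esub> p x) w"
    proof eventually_elim
      case (elim w)
      then obtain n where "w \<in> A n" using partition_cover[OF A] by blast
      with elim show ?case by (simp add: p)
    qed
  qed
qed

text \<open>Each member comes with its own partition. Finitely many partitions have a common
  refinement, and on each of its pieces the union of the sets of seminorms involved dominates all
  members.\<close>

lemma cc_family_dominated:
  assumes "finite R" "R \<subseteq> cc_family M P"
  shows "\<exists>A Q. measurable_partition M A \<and> (\<forall>n. finite (Q n) \<and> Q n \<subseteq> P) \<and>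
    (\<forall>x\<in>carrier E. AE w in M. \<forall>n. w \<in> A n \<longrightarrow> (\<forall>p\<in>R. L0_rep (p x) w \<le> sn (Q n) x w))"
  using assms
proof (induction R rule: finite_induct)
  case empty
  \<comment> \<open>The trivial partition, padded with empty sets to an infinite sequence.\<close>
  have "measurable_partition M (\<lambda>n. if n = 0 then space M else {})"
    by (auto simp: measurable_partition_def disjoint_family_on_def)
  then show ?case by (intro exI[of _ "\<lambda>n. if n = 0 then space M else {}"] exI[of _ "\<lambda>n. {}"]) simp
next
  case (insert p R)
  have "R \<subseteq> cc_family M P" using insert.prems by simp
  from insert.IH[OF this] obtain A Q where A: "measurable_partition M A"
    and Q: "\<And>n. finite (Q n)" "\<And>n. Q n \<subseteq> P"
    and le: "\<And>x. x \<in> carrier E \<Longrightarrow>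
      AE w in M. \<forall>n. w \<in> A n \<longrightarrow> (\<forall>p\<in>R. L0_rep (p x) w \<le> sn (Q n) x w)"
    by blast
  have "p \<in> cc_family M P" using insert.prems by simp
  then obtain B S where p: "p = cc_seminorm M B S" and B: "measurable_partition M B"
    and S: "\<And>n. finite (S n)" "\<And>n. S n \<subseteq> P"
    unfolding cc_family_def by blast
  \<comment> \<open>Pairs of indices are numbered by \<open>prod_decode\<close>; \<open>C\<close> is
    the common refinement and \<open>T\<close> joins the sets attached to the two pieces.\<close>
  define C where "C n = A (fst (prod_decode n)) \<inter> B (snd (prod_decode n))" for n
  define T where "T n = Q (fst (prod_decode n)) \<union> S (snd (prod_decode n))" for n
  have "disjoint_family C"
    unfolding disjoint_family_on_def
  proof (intro ballI impI)
    fix m n :: nat assume "m \<noteq> n"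
    then have "prod_decode m \<noteq> prod_decode n" by (simp add: inj_eq inj_prod_decode)
    then have "fst (prod_decode m) \<noteq> fst (prod_decode n) \<or> snd (prod_decode m) \<noteq> snd (prod_decode n)"
      by (auto simp: prod_eq_iff)
    then show "C m \<inter> C n = {}"
      using A B unfolding C_def measurable_partition_def disjoint_family_on_def by blast
  qed
  moreover have "(\<Union>n. C n) = space M"
  proof (intro equalityI subsetI)
    fix w assume "w \<in> space M"
    then obtain i j where "w \<in> A i" "w \<in> B j"
      using partition_cover[OF A] partition_cover[OF B] by blast
    then have "w \<in> C (prod_encode (i, j))" by (simp add: C_def)
    then show "w \<in> (\<Union>n. C n)" by blast
  qed (use A in \<open>auto simp: C_def measurable_partition_def\<close>)
  moreover have "C n \<in> sets M" for n using A B by (auto simp: C_def measurable_partition_def)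
  ultimately have C: "measurable_partition M C" by (simp add: measurable_partition_def)
  have T: "finite (T n)" "T n \<subseteq> P" for n using Q S by (auto simp: T_def)
  have "AE w in M. \<forall>n. w \<in> C n \<longrightarrow> (\<forall>q\<in>insert p R. L0_rep (q x) w \<le> sn (T n) x w)"
    if x: "x \<in> carrier E" for x
  proof -
    have "AE w in M. sn (Q (fst (prod_decode n))) x w \<le> sn (T n) x w \<and>
      sn (S (snd (prod_decode n))) x w \<le> sn (T n) x w" for n
      by (intro AE_conjI sn_mono T x) (auto simp: T_def)
    then have "AE w in M. \<forall>n. sn (Q (fst (prod_decode n))) x w \<le> sn (T n) x w \<and>
      sn (S (snd (prod_decode n))) x w \<le> sn (T n) x w"
      by (intro AE_all_countable[THEN iffD2] allI)
    with le[OF x] cc_seminorm_rep(2)[of B S, OF B S x] show ?thesis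
    proof eventually_elim
      case (elim w)
      show ?case
      proof (intro allI impI ballI)
        fix n q assume w: "w \<in> C n" and q: "q \<in> insert p R"
        have "w \<in> A (fst (prod_decode n))" "w \<in> B (snd (prod_decode n))" using w by (auto simp: C_def)
        with elim q have "L0_rep (q x) w \<le> sn (Q (fst (prod_decode n))) x w
            \<or> L0_rep (q x) w \<le> sn (S (snd (prod_decode n))) x w"
          by (auto simp: p)
        with elim(3) show "L0_rep (q x) w \<le> sn (T n) x w" by (meson order_trans)
      qed
    qed
  qed
  with C T show ?case by (intro exI[of _ C] exI[of _ T]) blast
qed

text \<open>A bound by finitely many concatenated seminorms is localised along a common partition.
  Conversely, the data of local boundedness define a single concatenated seminorm, which bounds
  \<open>f\<close> globally.\<close>

lemma dual_c_cc_family_eq: "dual_c M E (cc_family M P) = {f \<in> L0_hom M E. locally_bounded f}"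
proof (intro equalityI subsetI)
  interpret cc: L0_homogeneous_family M E "cc_family M P" by (rule cc_homogeneous)
  fix f
  {
    assume f: "f \<in> dual_c M E (cc_family M P)"
    from cc.dual_c_imp_bound[OF this] obtain R c where R: "finite R" "R \<subseteq> cc_family M P"
      and c: "c \<in> borel_measurable M"
      and bound: "\<And>x. x \<in> carrier E \<Longrightarrow> AE w in M. norm (L0_rep (f x) w) \<le> c w * sn R x w"
      by blast
    from cc_family_dominated[OF R] obtain A Q where A: "measurable_partition M A"
      and Q: "\<And>n. finite (Q n)" "\<And>n. Q n \<subseteq> P"
      and le: "\<And>x. x \<in> carrier E \<Longrightarrow>
        AE w in M. \<forall>n. w \<in> A n \<longrightarrow> (\<forall>p\<in>R. L0_rep (p x) w \<le> sn (Q n) x w)"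
      by blast
    have "locally_bounded f"
    proof (rule locally_boundedI[OF A Q])
      \<comment> \<open>The absolute value is taken because enlarging the seminorm preserves the
        bound only for a nonnegative factor.\<close>
      show "(\<lambda>w. \<bar>c w\<bar>) \<in> borel_measurable M" using c by measurable
      fix n x assume x: "x \<in> carrier E"
      from bound[OF x] le[OF x] cc.sn_eq_Max[OF R x] sn_nonneg[OF Q(1)[of n] Q(2)[of n] x]
      show "AE w in M. w \<in> A n \<longrightarrow> norm (L0_rep (f x) w) \<le> \<bar>c w\<bar> * sn (Q n) x w"
      proof eventually_elim
        case (elim w)
        show ?case
        proof
          assume "w \<in> A n"
          then have le: "sn R x w \<le> sn (Q n) x w" using elim R(1) by simp
          have nonneg: "0 \<le> sn R x w" using elim(3) R(1) by simp
          have "norm (L0_rep (f x) w) \<le> c w * sn R x w" by (rule elim(1))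
          also have "\<dots> \<le> \<bar>c w\<bar> * sn R x w" using nonneg by (intro mult_right_mono) auto
          also have "\<dots> \<le> \<bar>c w\<bar> * sn (Q n) x w" using le by (intro mult_left_mono) auto
          finally show "norm (L0_rep (f x) w) \<le> \<bar>c w\<bar> * sn (Q n) x w" .
        qed
      qed
    qed
    with f show "f \<in> {f \<in> L0_hom M E. locally_bounded f}" by (simp add: dual_c_def)
  }
  assume "f \<in> {f \<in> L0_hom M E. locally_bounded f}"
  then obtain A Q c where f: "f \<in> L0_hom M E" and A: "measurable_partition M A"
    and Q: "\<And>n. finite (Q n)" "\<And>n. Q n \<subseteq> P" and c: "c \<in> borel_measurable M"
    and bound: "\<And>x. x \<in> carrier E \<Longrightarrow>
      AE w in M. \<forall>n. w \<in> A n \<longrightarrow> norm (L0_rep (f x) w) \<le> c w * sn (Q n) x w"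
    unfolding locally_bounded_def by blast
  let ?p = "cc_seminorm M A Q"
  have "?p \<in> cc_family M P" unfolding cc_family_def using A Q by blast
  then have p: "finite {?p}" "{?p} \<subseteq> cc_family M P" by simp_all
  show "f \<in> dual_c M E (cc_family M P)"
  proof (rule cc.bound_imp_dual_c[OF f p c])
    fix x assume x: "x \<in> carrier E"
    show "AE w in M. norm (L0_rep (f x) w) \<le> c w * sn {?p} x w"
      using bound[OF x] cc.sn_eq_Max[OF p x] cc_seminorm_rep(2)[of A Q, OF A Q x]
        L0_plus_rep_nonneg[OF cc_seminorm_rep(1)[of A Q, OF A Q x]] AE_space
    proof eventually_elim
      case (elim w)
      then obtain n where "w \<in> A n" using partition_cover[OF A] by blast
      with elim show ?case by simp
    qed
  qed
qed


section \<open>The concatenation hull of the dual\<close>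

text \<open>Linearity is not part of membership in the hull; it is recovered piece by piece from the
  \<open>g n\<close>, and the partition also glues their bounds. Conversely, a locally bounded
  homomorphism is the concatenation of its restrictions to the pieces, each bounded by one finite
  supremum.\<close>

lemma cc_hull_dual_c_eq: "cc_hull M E (dual_c M E P) = {f \<in> L0_hom M E. locally_bounded f}"
proof (intro equalityI subsetI)
  fix f assume "f \<in> cc_hull M E (dual_c M E P)"
  then obtain A g where f: "f \<in> carrier E \<rightarrow>\<^sub>E carrier (L0 M)" and A: "measurable_partition M A"
    and g: "\<And>n. g n \<in> dual_c M E P"
    and eq: "\<And>n x. x \<in> carrier E \<Longrightarrow> L0_ind M (A n) \<odot>\<^bsub>L0 M\<^esub> f x = L0_ind M (A n) \<odot>\<^bsub>L0 M\<^esub> g n x"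
    unfolding cc_hull_def by blast
  have fc: "f x \<in> carrier (L0 M)" if "x \<in> carrier E" for x using f that by auto
  have hom: "g n \<in> L0_hom M E" for n using g[of n] by (simp add: dual_c_def)
  have An: "A n \<in> sets M" for n using A by (simp add: measurable_partition_def)
  have local: "AE w in M. \<forall>n. w \<in> A n \<longrightarrow> L0_rep (f x) w = L0_rep (g n x) w" if x: "x \<in> carrier E" for x
  proof -
    have "AE w in M. w \<in> A n \<longrightarrow> L0_rep (f x) w = L0_rep (g n x) w" for n
      using L0_rep_ops(3)[OF L0_ind_closed[OF An[of n]] fc[OF x]] L0_rep_ind[OF An[of n], where ?'k = 'k]
        L0_rep_ops(3)[OF L0_ind_closed[OF An[of n]] L0_hom_carrier[OF hom[of n] x]]
      by eventually_elim (auto simp: eq[OF x])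
    then show ?thesis by (intro AE_all_countable[THEN iffD2] allI)
  qed
  \<comment> \<open>Almost every point lies in some \<open>A n\<close> where the values of
    \<open>f\<close> are those of the homomorphism \<open>g n\<close>.\<close>
  have "f \<in> L0_hom M E"
    unfolding L0_hom_def
  proof (intro CollectI conjI ballI f)
    fix x y assume x: "x \<in> carrier E" and y: "y \<in> carrier E"
    then have xy: "x \<oplus>\<^bsub>E\<^esub> y \<in> carrier E" by simp
    have add: "AE w in M. \<forall>n. L0_rep (g n (x \<oplus>\<^bsub>E\<^esub> y)) w = L0_rep (g n x) w + L0_rep (g n y) w"
      by (intro AE_all_countable[THEN iffD2] allI hom_rep_add hom x y)
    show "f (x \<oplus>\<^bsub>E\<^esub> y) = f x \<oplus>\<^bsub>L0 M\<^esub> f y"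
    proof (rule L0_eqI[OF fc[OF xy] L0_ops_closed(1)[OF fc[OF x] fc[OF y]]])
      show "AE w in M. L0_rep (f (x \<oplus>\<^bsub>E\<^esub> y)) w = L0_rep (f x \<oplus>\<^bsub>L0 M\<^esub> f y) w"
        using local[OF x] local[OF y] local[OF xy] add L0_rep_ops(1)[OF fc[OF x] fc[OF y]] AE_space
      proof eventually_elim
        case (elim w)
        then obtain n where "w \<in> A n" using partition_cover[OF A] by blast
        with elim show ?case by simp
      qed
    qed
  next
    fix \<xi> :: "('w \<Rightarrow> 'k) set" and x
    assume \<xi>: "\<xi> \<in> carrier (L0 M)" and x: "x \<in> carrier E"
    then have \<xi>x: "\<xi> \<odot>\<^bsub>E\<^esub> x \<in> carrier E" by simp
    have mult: "AE w in M. \<forall>n. L0_rep (g n (\<xi> \<odot>\<^bsub>E\<^esub> x)) w = L0_rep \<xi> w * L0_rep (g n x) w"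
      by (intro AE_all_countable[THEN iffD2] allI L0_hom_rep_smult hom x \<xi>)
    show "f (\<xi> \<odot>\<^bsub>E\<^esub> x) = \<xi> \<odot>\<^bsub>L0 M\<^esub> f x"
    proof (rule L0_eqI[OF fc[OF \<xi>x] L0_ops_closed(3)[OF \<xi> fc[OF x]]])
      show "AE w in M. L0_rep (f (\<xi> \<odot>\<^bsub>E\<^esub> x)) w = L0_rep (\<xi> \<odot>\<^bsub>L0 M\<^esub> f x) w"
        using local[OF x] local[OF \<xi>x] mult L0_rep_ops(3)[OF \<xi> fc[OF x]] AE_space
      proof eventually_elim
        case (elim w)
        then obtain n where "w \<in> A n" using partition_cover[OF A] by blast
        with elim show ?case by simp
      qed
    qed
  qed
  moreover have "locally_bounded f"
  proof -
    define good where "good n Q c \<longleftrightarrow> finite Q \<and> Q \<subseteq> P \<and> c \<in> borel_measurable M \<and>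
      (\<forall>x\<in>carrier E. AE w in M. norm (L0_rep (g n x) w) \<le> c w * sn Q x w)" for n Q c
    have "\<exists>Q c. good n Q c" for n
      by (rule dual_c_imp_bound[OF g[of n]]) (unfold good_def, blast)
    then obtain Q c where "\<And>n. good n (Q n) (c n)" by metis
    then have Q: "\<And>n. finite (Q n)" "\<And>n. Q n \<subseteq> P" and c: "\<And>n. c n \<in> borel_measurable M"
      and bound: "\<And>n x. x \<in> carrier E \<Longrightarrow> AE w in M. norm (L0_rep (g n x) w) \<le> c n w * sn (Q n) x w"
      unfolding good_def by blast+
    show ?thesis
    proof (rule locally_boundedI[OF A Q c])
      fix n x assume x: "x \<in> carrier E"
      show "AE w in M. w \<in> A n \<longrightarrow> norm (L0_rep (f x) w) \<le> c n w * sn (Q n) x w"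
        using local[OF x] bound[OF x, of n] by eventually_elim auto
    qed
  qed
  ultimately show "f \<in> {f \<in> L0_hom M E. locally_bounded f}" by simp
next
  fix f assume "f \<in> {f \<in> L0_hom M E. locally_bounded f}"
  then obtain A Q c where f: "f \<in> L0_hom M E" and A: "measurable_partition M A"
    and Q: "\<And>n. finite (Q n)" "\<And>n. Q n \<subseteq> P" and c[measurable]: "c \<in> borel_measurable M"
    and bound: "\<And>x. x \<in> carrier E \<Longrightarrow>
      AE w in M. \<forall>n. w \<in> A n \<longrightarrow> norm (L0_rep (f x) w) \<le> c w * sn (Q n) x w"
    unfolding locally_bounded_def by blast
  have An[measurable]: "A n \<in> sets M" for n using A by (simp add: measurable_partition_def)
  have K: "cring (L0 M :: (('w \<Rightarrow> 'k) set, _) module)" by (rule L0_cring)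
  interpret K: Module.module "L0 M" "L0 M :: (('w \<Rightarrow> 'k) set, _) module" by (rule L0_module)
  \<comment> \<open>The indicator removes all points outside \<open>A n\<close>, where the seminorms
    of \<open>Q n\<close> give no control.\<close>
  define g where "g n = (\<lambda>x\<in>carrier E. L0_ind M (A n) \<odot>\<^bsub>L0 M\<^esub> f x)" for n
  note i = L0_ind_closed[OF An, where ?'k = 'k]
  have fc: "f x \<in> carrier (L0 M)" if "x \<in> carrier E" for x using f that by (rule L0_hom_carrier)
  have hom: "g n \<in> L0_hom M E" for n
    unfolding L0_hom_def
  proof (intro CollectI conjI ballI)
    show "g n \<in> carrier E \<rightarrow>\<^sub>E carrier (L0 M)" unfolding g_def using i fc by auto
    show "g n (x \<oplus>\<^bsub>E\<^esub> y) = g n x \<oplus>\<^bsub>L0 M\<^esub> g n y" if "x \<in> carrier E" "y \<in> carrier E" for x y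
      using f that i fc by (simp add: g_def L0_hom_def K.smult_r_distr)
    show "g n (\<xi> \<odot>\<^bsub>E\<^esub> x) = \<xi> \<odot>\<^bsub>L0 M\<^esub> g n x" if "\<xi> \<in> carrier (L0 M)" "x \<in> carrier E" for \<xi> x
      using f that i fc by (simp add: g_def L0_hom_def cring.cring_simprules(14)[OF K] flip: K.smult_assoc1)
  qed
  have rep: "AE w in M. L0_rep (g n x) w = indicator (A n) w * L0_rep (f x) w" if x: "x \<in> carrier E" for n x
    using L0_rep_ops(3)[OF i[of n] fc[OF x]] L0_rep_ind[OF An, where ?'k = 'k, of n]
    by eventually_elim (simp add: g_def x)
  have "g n \<in> dual_c M E P" for n
  proof (rule bound_imp_dual_c[OF hom Q])
    show "(\<lambda>w. indicator (A n) w * c w) \<in> borel_measurable M" by measurable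
    fix x assume x: "x \<in> carrier E"
    show "AE w in M. norm (L0_rep (g n x) w) \<le> indicator (A n) w * c w * sn (Q n) x w"
      using rep[OF x, of n] bound[OF x] by eventually_elim (auto simp: indicator_def)
  qed
  moreover have "L0_ind M (A n) \<odot>\<^bsub>L0 M\<^esub> f x = L0_ind M (A n) \<odot>\<^bsub>L0 M\<^esub> g n x" if x: "x \<in> carrier E" for n x
    using x i fc by (simp add: g_def L0_ind_mult An flip: K.smult_assoc1)
  moreover have "f \<in> carrier E \<rightarrow>\<^sub>E carrier (L0 M)" using f by (simp add: L0_hom_def)
  ultimately show "f \<in> cc_hull M E (dual_c M E P)"
    unfolding cc_hull_def using A by blast
qed

end

theorem theorem2p30:
  fixes M :: "'w measure"
    and E :: "(('w \<Rightarrow> 'k::{real_normed_field, euclidean_space}) set, 'e) module"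
    and P :: "('e \<Rightarrow> ('w \<Rightarrow> real) set) set"
  assumes "prob_space M"
    and "random_locally_convex_module M E P"
  shows "dual_eps_lambda M E P = dual_c M E (cc_family M P)
    \<and> dual_c M E (cc_family M P) = cc_hull M E (dual_c M E P)"
proof -
  interpret L0_homogeneous_family M E P
    using assms
    by (auto simp: L0_homogeneous_family_def L0_homogeneous_family_axioms_def
        random_locally_convex_module_def L0_seminorm_def)
  show ?thesis by (simp add: dual_eps_lambda_eq dual_c_cc_family_eq cc_hull_dual_c_eq)
qed

end
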